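(* Let $M=M_n$ be integers satisfying, as $n\to\infty$, $$n\le M\le n\log n,\qquad \frac{\lambda_{n,M}}{(\log M)^2}\to\infty,\qquad \lambda_{n,M}:=n\left(1-\frac1n\right)^M .$$ Let $T_{n,M}$ be the first time that the expiring coupon collector has all $n$ types simultaneously active, and let $$\mu_{n,M}=\frac{(n-1)\,(n-1)!\,S(M-1,n-1)}{n^M}.$$ Then $$\mu_{n,M}T_{n,M}\Rightarrow \mathrm{Exp}(1)$$ in distribution as $n\to\infty$. Moreover, for every fixed integer $r\ge1$, $$\mathbb E\big[(\mu_{n,M}T_{n,M})^r\big]\to r!,$$ and in particular $$\mathbb E\,T_{n,M}\sim\frac1{\mu_{n,M}},\qquad \mathrm{Var}(T_{n,M})\sim\frac1{\mu_{n,M}^2}.$$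
   Context: $[n]=\{1,\dots,n\}$. In the expiring coupon collector started empty, coupons $X_1,X_2,\dots$ are iid uniform on $[n]$, one drawn at each time, and each coupon stays active for exactly $M$ draws. The completion time is $T_{n,M}=\inf\{t\ge n:\{X_{\max(1,t-M+1)},\dots,X_t\}=[n]\}$. $S(\cdot,\cdot)$ denotes a Stirling number of the second kind. $\mathrm{Exp}(1)$ is the exponential distribution with mean $1$, $\Rightarrow$ denotes convergence in distribution, and $a_n\sim b_n$ means $a_n/b_n\to1$. *)

theory Defs
  imports "HOL-Probability.Probability" "HOL-Combinatorics.Stirling"
    "HOL-Library.Landau_Symbols"
begin

text \<open>Completion time along one coupon sequence \<open>x 1, x 2, \<dots>\<close> (\<open>x 0\<close> is never used). The value is
  \<open>\<infinity>\<close> when no window ever contains all \<open>n\<close> types. Truncated subtraction in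
  \<open>t + 1 - M\<close> is harmless because of the maximum with \<open>1\<close>.\<close>

definition completion_time :: "nat \<Rightarrow> nat \<Rightarrow> (nat \<Rightarrow> nat) \<Rightarrow> ennreal" where
  "completion_time n M x =
     (INF t \<in> {t. n \<le> t \<and> x ` {max 1 (t + 1 - M)..t} = {1..n}}. of_nat t)"

definition coupon_lambda :: "nat \<Rightarrow> nat \<Rightarrow> real" where
  "coupon_lambda n M = real n * (1 - 1 / real n) ^ M"

definition coupon_mu :: "nat \<Rightarrow> nat \<Rightarrow> real" where
  "coupon_mu n M =
     (real n - 1) * fact (n - 1) * real (Stirling (M - 1) (n - 1)) / real n ^ M"

text \<open>\<open>X 1, X 2, \<dots>\<close> are iid uniform on \<open>{1..n}\<close>, for \<open>n \<ge> 1\<close>. Measurability of each \<open>X t\<close> is part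
  of \<open>indep_vars\<close>.\<close>

definition uniform_coupons :: "'a measure \<Rightarrow> nat \<Rightarrow> (nat \<Rightarrow> 'a \<Rightarrow> nat) \<Rightarrow> bool" where
  "uniform_coupons \<Omega> n X \<longleftrightarrow>
     prob_space \<Omega> \<and>
     prob_space.indep_vars \<Omega> (\<lambda>_. count_space UNIV) X {1..} \<and>
     (\<forall>t\<ge>1. distr \<Omega> (count_space UNIV) (X t) = measure_pmf (pmf_of_set {1..n}))"

end

(* A window "enters fullness" when it is full and its predecessor is not; this happens at each time
   with probability exactly mu.

   The key estimate is that, given a full window, the window h = o(n) steps later is full with
   probability smaller than any power of M. Conditioning on the common part of the two windows makes
   the pair probability an L2 norm, hence decreasing in h, so one value of h settles all larger lags.
   For that h an exponential (Chernoff) bound for the generating function of the number of missing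
   types is compared with a lower bound for the covering probability, whose log-concavity in the
   number of letters allows the saddle point to be tuned at a polynomial cost. At lags below h a
   second entry costs a factor 1/n because it needs one specific letter.

   So entries do not clump, and Bonferroni's inequalities give the failure probability of a block of
   length M^2 as M^2 mu (1 + o(1)). Sub- and almost-supermultiplicativity of the survival
   probability over blocks yield the limit exp(-x) together with a geometric bound on the tail, and
   the moments follow by dominated convergence. *)

theory Submission
  imports Defs
begin

section \<open>Averages over words and the missing-type chain\<close>

text \<open>A window is full with exponentially small probability, and the pair probability has to
  be compared with it up to a power of M. The product bound (1 - (1 - 1/n)^M)^n is too weak for
  that: at M = n it is about (1 - 1/e)^n, while the truth n!/n^n is e^(-n) up to a power of n. Upper
  and lower estimates are therefore read off the same Poissonized generating function at the same
  parameter \<rho>. In the squared conditional covering probability one factor gets the Chernoff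
  bound and reproduces the single-window probability; the other gets the product bound and supplies
  the whole gain, an exponent of order h * \<lambda> / M. The lag h must be o(n), so that pairs
  closer than h are harmless, yet h * \<lambda> / M must exceed any multiple of log M. This is where
  M \<le> n log n and \<lambda> / (log M)^2 \<rightarrow> \<infinity> are spent together. Errors are
  measured against the entry rate, not against \<open>full_prob\<close>. The link is that fullness
  is left as often as it is entered, which bounds \<open>full_prob\<close> by 2 M times the rate.
  All estimates concern averages over finite words; the given probability spaces enter only when
  survival probabilities are identified with tails of T.\<close>

fun word_mean :: "nat \<Rightarrow> nat \<Rightarrow> (nat list \<Rightarrow> real) \<Rightarrow> real" where
  "word_mean n 0 f = f []"
| "word_mean n (Suc L) f = (\<Sum>c=1..n. word_mean n L (\<lambda>w. f (c # w))) / real n"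

text \<open>Independence of successive stretches of draws: with averages defined by recursion over
  letters, Fubini is an induction.\<close>

lemma word_mean_append:
  "word_mean n (a + b) f = word_mean n a (\<lambda>u. word_mean n b (\<lambda>v. f (u @ v)))"
  by (induction a arbitrary: f) auto

lemma word_mean_mono:
  assumes "\<And>w. length w = L \<Longrightarrow> set w \<subseteq> {1..n} \<Longrightarrow> f w \<le> g w"
  shows "word_mean n L f \<le> word_mean n L g"
  using assms
  by (induction L arbitrary: f g) (auto intro!: divide_right_mono sum_mono)

lemma word_mean_cong:
  assumes "\<And>w. length w = L \<Longrightarrow> set w \<subseteq> {1..n} \<Longrightarrow> f w = g w"
  shows "word_mean n L f = word_mean n L g"
  using assms by (intro antisym word_mean_mono) auto

lemma word_mean_add:
  "word_mean n L (\<lambda>w. f w + g w) = word_mean n L f + word_mean n L g"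
  by (induction L arbitrary: f g) (auto simp: sum.distrib add_divide_distrib)

lemma word_mean_cmult: "word_mean n L (\<lambda>w. c * f w) = c * word_mean n L f"
  by (induction L arbitrary: f) (auto simp: sum_distrib_left)

lemma word_mean_multc: "word_mean n L (\<lambda>w. f w * c) = word_mean n L f * c"
  using word_mean_cmult[of n L c f] by (simp add: mult.commute)

lemma word_mean_diff:
  "word_mean n L (\<lambda>w. f w - g w) = word_mean n L f - word_mean n L g"
  using word_mean_add[of n L f "\<lambda>w. (-1) * g w"] word_mean_cmult[of n L "-1" g] by simp

lemma word_mean_zero: "word_mean n L (\<lambda>w. 0) = 0"
  by (induction L) auto

lemma word_mean_sum:
  "word_mean n L (\<lambda>w. \<Sum>i\<in>I. f i w) = (\<Sum>i\<in>I. word_mean n L (f i))"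
  by (induction I rule: infinite_finite_induct) (auto simp: word_mean_add word_mean_zero)

lemma word_mean_const:
  assumes "n \<ge> 1"
  shows "word_mean n L (\<lambda>w. c) = c"
  using assms by (induction L) auto

lemma word_mean_nonneg:
  assumes "\<And>w. length w = L \<Longrightarrow> set w \<subseteq> {1..n} \<Longrightarrow> 0 \<le> f w"
  shows "0 \<le> word_mean n L f"
  using word_mean_mono[of L n "\<lambda>_. 0" f] assms by (simp add: word_mean_zero)

lemma word_mean_swap:
  "word_mean n a (\<lambda>u. word_mean n b (\<lambda>v. f u v)) = word_mean n b (\<lambda>v. word_mean n a (\<lambda>u. f u v))"
proof (induction a arbitrary: f)
  case (Suc a)
  have "word_mean n b (\<lambda>v. (\<Sum>c=1..n. word_mean n a (\<lambda>w. f (c # w) v)) / n)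
     = word_mean n b (\<lambda>v. \<Sum>c=1..n. word_mean n a (\<lambda>w. f (c # w) v)) / n"
    using word_mean_multc[of n b _ "1 / n"] by simp
  then show ?case
    using Suc by (simp add: word_mean_sum)
qed simp

lemma word_mean_prod:
  "word_mean n a (\<lambda>u. word_mean n b (\<lambda>v. f u * g v)) = word_mean n a f * word_mean n b g"
  by (simp add: word_mean_cmult word_mean_multc)

lemma word_mean_factor:
  assumes "n \<ge> 1" "i + k \<le> L"
  shows "word_mean n L (\<lambda>w. f (take k (drop i w))) = word_mean n k f"
proof -
  obtain j where L: "L = i + (k + j)"
    using assms(2) by (metis add.assoc le_Suc_ex)
  have "word_mean n L (\<lambda>w. f (take k (drop i w)))
      = word_mean n i (\<lambda>u. word_mean n k (\<lambda>v. word_mean n j (\<lambda>x. f v)))"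
    unfolding L word_mean_append by (intro word_mean_cong) simp
  then show ?thesis
    by (simp add: word_mean_const[OF assms(1)])
qed

lemma word_mean_square_le:
  assumes "n \<ge> 1"
  shows "(word_mean n L f)\<^sup>2 \<le> word_mean n L (\<lambda>w. (f w)\<^sup>2)"
proof -
  let ?m = "word_mean n L f"
  have "0 \<le> word_mean n L (\<lambda>w. (f w - ?m)\<^sup>2)"
    by (intro word_mean_nonneg) simp
  also have "(\<lambda>w. (f w - ?m)\<^sup>2) = (\<lambda>w. ((f w)\<^sup>2 - (2 * ?m) * f w) + ?m\<^sup>2)"
    by (auto simp: power2_eq_square algebra_simps)
  also have "word_mean n L \<dots> = word_mean n L (\<lambda>w. (f w)\<^sup>2) - 2 * ?m * ?m + ?m\<^sup>2"
    by (simp add: word_mean_add word_mean_diff word_mean_cmult word_mean_const[OF assms])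
  finally show ?thesis by (simp add: power2_eq_square)
qed

section \<open>The death chain counting missing types, and its generating function\<close>

fun miss_iter :: "nat \<Rightarrow> nat \<Rightarrow> (nat \<Rightarrow> real) \<Rightarrow> nat \<Rightarrow> real" where
  "miss_iter n 0 f k = f k"
| "miss_iter n (Suc m) f k =
     real k / real n * miss_iter n m f (k - 1) + (1 - real k / real n) * miss_iter n m f k"

text \<open>A uniform letter hits a k-element set with probability k/n and then removes one element,
  so only the cardinality matters. \<open>miss_iter\<close> is the backward equation of this chain:
  the mean of f after m draws, started from k missing types.\<close>

lemma word_mean_miss:
  assumes "n \<ge> 1" "S \<subseteq> {1..n}"
  shows "word_mean n m (\<lambda>w. f (card (S - set w))) = miss_iter n m f (card S)"
  using assms(2)
proof (induction m arbitrary: S)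
  case (Suc m)
  have fin: "finite S" using Suc.prems finite_subset by blast
  have le: "card S \<le> n" using card_mono[OF _ Suc.prems] by simp
  have *: "word_mean n m (\<lambda>w. f (card (S - set (c # w)))) = miss_iter n m f (card (S - {c}))" for c
  proof -
    have "S - set (c # w) = (S - {c}) - set w" for w by auto
    then show ?thesis using Suc.IH[of "S - {c}"] Suc.prems by auto
  qed
  have "(\<Sum>c=1..n. miss_iter n m f (card (S - {c})))
      = (\<Sum>c\<in>S. miss_iter n m f (card (S - {c}))) + (\<Sum>c\<in>{1..n} - S. miss_iter n m f (card (S - {c})))"
    using sum.subset_diff[OF Suc.prems] by (subst add.commute) blast
  also have "(\<Sum>c\<in>S. miss_iter n m f (card (S - {c}))) = (\<Sum>c\<in>S. miss_iter n m f (card S - 1))"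
    using fin by (intro sum.cong) auto
  also have "(\<Sum>c\<in>{1..n} - S. miss_iter n m f (card (S - {c})))
      = (\<Sum>c\<in>{1..n} - S. miss_iter n m f (card S))"
    by (intro sum.cong) auto
  also have "(\<Sum>c\<in>{1..n} - S. miss_iter n m f (card S)) = (real n - card S) * miss_iter n m f (card S)"
    using fin le Suc.prems by (simp add: card_Diff_subset of_nat_diff)
  finally have "(\<Sum>c=1..n. miss_iter n m f (card (S - {c})))
      = card S * miss_iter n m f (card S - 1) + (real n - card S) * miss_iter n m f (card S)"
    by simp
  then show ?case
    using assms(1) by (simp add: * field_simps del: list.set)
qed simp

lemma miss_iter_mono:
  assumes "\<And>k. k \<le> n \<Longrightarrow> f k \<le> g k" "k \<le> n"
  shows "miss_iter n m f k \<le> miss_iter n m g k"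
  using assms(2)
proof (induction m arbitrary: k)
  case (Suc m)
  then show ?case
    by (auto intro!: add_mono mult_left_mono simp: divide_le_eq)
qed (use assms in auto)

lemma miss_iter_nonneg:
  assumes "\<And>k. k \<le> n \<Longrightarrow> 0 \<le> f k" "k \<le> n"
  shows "0 \<le> miss_iter n m f k"
  using assms(2)
proof (induction m arbitrary: k)
  case (Suc m)
  then show ?case
    by (auto intro!: add_nonneg_nonneg mult_nonneg_nonneg simp: divide_le_eq)
qed (use assms in auto)

lemma miss_iter_cmult: "miss_iter n m (\<lambda>k. c * f k) k = c * miss_iter n m f k"
  by (induction m arbitrary: k) (auto simp: algebra_simps)

text \<open>The first two terms of the binomial expansion; this is the one-step comparison in
  \<open>miss_iter_le_power\<close>.\<close>

lemma power_add_ge: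
  fixes t s :: real
  assumes "0 \<le> t" "0 \<le> s"
  shows "t ^ k + real k * (t ^ (k - 1) * s) \<le> (t + s) ^ k"
proof (induction k)
  case (Suc i)
  show ?case
  proof (cases i)
    case (Suc j)
    have "(t ^ i + real i * (t ^ (i - 1) * s)) * (t + s)
        = t ^ Suc i + real (Suc i) * (t ^ (Suc i - 1) * s) + real i * t ^ (i - 1) * s\<^sup>2"
      using Suc by (simp add: algebra_simps power2_eq_square)
    moreover have "(t ^ i + real i * (t ^ (i - 1) * s)) * (t + s) \<le> (t + s) ^ i * (t + s)"
      using Suc.IH assms by (intro mult_right_mono) auto
    moreover have "0 \<le> real i * t ^ (i - 1) * s\<^sup>2" using assms by simp
    ultimately show ?thesis unfolding power_Suc2 by linarith
  qed simp
qed simp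

text \<open>Occurrences of different letters are negatively correlated, so k letters all occur in h
  draws with at most the product of the single probabilities. With s = (1 - t)/n, one step of the
  chain is the first-order part of (t + s)^k. The function 0^k is the indicator of k = 0.\<close>

lemma miss_iter_le_power:
  assumes "n \<ge> 1" "k \<le> n"
  shows "miss_iter n h (\<lambda>k. 0 ^ k) k \<le> (1 - (1 - 1 / real n) ^ h) ^ k"
  using assms(2)
proof (induction h arbitrary: k)
  case (Suc h)
  define t where "t = 1 - (1 - 1 / real n) ^ h"
  have p: "(1 - 1 / real n) ^ h \<le> 1" "(1 - 1 / real n) ^ h \<ge> 0"
    using assms(1) by (auto intro!: power_le_one)
  have t: "0 \<le> t" "t \<le> 1" using p by (auto simp: t_def)
  have t': "1 - (1 - 1 / real n) ^ Suc h = t + (1 - t) / n"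
    using assms(1) by (simp add: t_def field_simps)
  have "miss_iter n (Suc h) (\<lambda>k. 0 ^ k) k \<le> real k / n * t ^ (k - 1) + (1 - real k / n) * t ^ k"
    using Suc.IH[of k] Suc.IH[of "k - 1"] Suc.prems
    by (auto intro!: add_mono mult_left_mono simp: t_def divide_le_eq)
  also have "\<dots> \<le> (t + (1 - t) / n) ^ k"
  proof (cases k)
    case (Suc j)
    have "t ^ k + real k * (t ^ (k - 1) * ((1 - t) / n)) \<le> (t + (1 - t) / n) ^ k"
      using t by (intro power_add_ge) auto
    moreover have "real k / n * t ^ (k - 1) + (1 - real k / n) * t ^ k
        = t ^ k + real k * (t ^ (k - 1) * ((1 - t) / n))"
      using Suc by (simp add: algebra_simps add_divide_distrib diff_divide_distrib)
    ultimately show ?thesis by simp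
  qed simp
  finally show ?case unfolding t' .
qed simp

text \<open>Factorial moments: a set of i letters is avoided by m draws with probability (1 -
  i/n)^m, and b^j expands in binomials of j around b = 1. Equivalently, the chain is diagonalised
  with eigenvalues 1 - i/n.\<close>

lemma miss_iter_power:
  assumes "n \<ge> 1"
  shows "miss_iter n m (\<lambda>k. b ^ k) k =
    (\<Sum>i\<le>k. real (k choose i) * (b - 1) ^ i * (1 - real i / real n) ^ m)"
proof (induction m arbitrary: k)
  case 0
  have "b ^ k = ((b - 1) + 1) ^ k" by simp
  also have "\<dots> = (\<Sum>i\<le>k. real (k choose i) * (b - 1) ^ i)"
    by (subst binomial_ring) simp
  finally show ?case by simp
next
  case (Suc m)
  show ?case
  proof (cases k)
    case 0
    then show ?thesis using Suc by simp
  next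
    case (Suc j)
    define g where "g i = (b - 1) ^ i * (1 - real i / real n) ^ m" for i
    have *: "real k * real (j choose i) = (real k - real i) * real (k choose i)" if "i \<le> k" for i
    proof -
      have "k * (j choose i) = (k - i) * (k choose i)"
        using binomial_absorb_comp[of k i] Suc by simp
      then have "real (k * (j choose i)) = real ((k - i) * (k choose i))" by simp
      then show ?thesis using that by (simp add: of_nat_diff)
    qed
    have "real k * miss_iter n m (\<lambda>k. b ^ k) (k - 1)
        = real k * (\<Sum>i\<le>k. real (j choose i) * g i)"
      using Suc Suc.IH[of j] by (simp add: g_def mult.assoc binomial_eq_0)
    also have "\<dots> = (\<Sum>i\<le>k. (real k - real i) * (real (k choose i) * g i))"
      unfolding sum_distrib_left mult.assoc[symmetric] by (intro sum.cong) (auto simp: * simp del: of_nat_Suc)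
    finally have 1: "real k * miss_iter n m (\<lambda>k. b ^ k) (k - 1)
        = (\<Sum>i\<le>k. (real k - real i) * (real (k choose i) * g i))" .
    have 2: "miss_iter n m (\<lambda>k. b ^ k) k = (\<Sum>i\<le>k. real (k choose i) * g i)"
      by (simp add: Suc.IH g_def mult.assoc)
    have "miss_iter n (Suc m) (\<lambda>k. b ^ k) k
        = (real k * miss_iter n m (\<lambda>k. b ^ k) (k - 1)) / n + (1 - real k / n) * miss_iter n m (\<lambda>k. b ^ k) k"
      by simp
    also have "\<dots> = (\<Sum>i\<le>k. (real k - real i) * (real (k choose i) * g i)) / n
        + (1 - real k / n) * (\<Sum>i\<le>k. real (k choose i) * g i)"
      unfolding 1 2 ..
    also have "\<dots> = (\<Sum>i\<le>k. (real k - real i) * (real (k choose i) * g i) / n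
        + (1 - real k / n) * (real (k choose i) * g i))"
      by (simp add: sum.distrib sum_divide_distrib sum_distrib_left)
    also have "\<dots> = (\<Sum>i\<le>k. real (k choose i) * (b - 1) ^ i * (1 - real i / real n) ^ Suc m)"
      using assms by (intro sum.cong) (auto simp: g_def field_simps)
    finally show ?thesis .
  qed
qed

text \<open>Poissonization: after a Poisson number of draws with mean n y the letters are
  independent, each missing with probability exp (- y) and then contributing b instead of 1. The
  normalising factor exp (- n y) is kept on the other side.\<close>

lemma miss_iter_sums:
  assumes "n \<ge> 1"
  shows "(\<lambda>m. (real n * y) ^ m / fact m * miss_iter n m (\<lambda>k. b ^ k) k)
     sums (exp (real n * y) * (1 - (1 - b) * exp (- y)) ^ k)"
proof -
  have "(\<lambda>m. \<Sum>i\<le>k. real (k choose i) * (b - 1) ^ i * (((real n - real i) * y) ^ m / fact m))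
     sums (\<Sum>i\<le>k. real (k choose i) * (b - 1) ^ i * exp ((real n - real i) * y))"
    by (intro sums_sum sums_mult) (use exp_converges[where 'a=real] in \<open>simp add: divide_inverse mult.commute\<close>)
  moreover have "(\<Sum>i\<le>k. real (k choose i) * (b - 1) ^ i * (((real n - real i) * y) ^ m / fact m))
     = (real n * y) ^ m / fact m * miss_iter n m (\<lambda>k. b ^ k) k" for m
  proof -
    have "real n * y * (1 - real i / n) = (real n - real i) * y" for i
      using assms by (simp add: field_simps)
    then have "((real n - real i) * y) ^ m = (real n * y) ^ m * (1 - real i / n) ^ m" for i
      by (metis power_mult_distrib)
    then show ?thesis
      by (simp add: miss_iter_power[OF assms] sum_distrib_left sum_divide_distrib mult_ac)
  qed
  moreover have "(\<Sum>i\<le>k. real (k choose i) * (b - 1) ^ i * exp ((real n - real i) * y))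
     = exp (real n * y) * (1 - (1 - b) * exp (- y)) ^ k"
  proof -
    have "exp (real n * y) * (1 - (1 - b) * exp (- y)) ^ k
        = exp (real n * y) * ((b - 1) * exp (- y) + 1) ^ k"
      by (simp add: algebra_simps)
    also have "\<dots> = (\<Sum>i\<le>k. real (k choose i) * (b - 1) ^ i * (exp (real n * y) * exp (- y) ^ i))"
      by (subst binomial_ring) (simp add: sum_distrib_left power_mult_distrib mult_ac)
    also have "(\<lambda>i. exp (real n * y) * exp (- y) ^ i) = (\<lambda>i. exp ((real n - real i) * y))"
      by (simp add: exp_of_nat_mult left_diff_distrib exp_diff exp_minus divide_inverse power_inverse fun_eq_iff)
    finally show ?thesis by simp
  qed
  ultimately show ?thesis by simp
qed

text \<open>A single term of a series of nonnegative terms is at most its sum; y stays free to be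
  chosen.\<close>

lemma miss_iter_chernoff:
  assumes "n \<ge> 1" "k \<le> n" "y > 0" "0 \<le> b"
  shows "miss_iter n m (\<lambda>k. b ^ k) k
     \<le> fact m / (real n * y) ^ m * (exp (real n * y) * (1 - (1 - b) * exp (- y)) ^ k)"
proof -
  have "(real n * y) ^ m / fact m * miss_iter n m (\<lambda>k. b ^ k) k
      \<le> exp (real n * y) * (1 - (1 - b) * exp (- y)) ^ k"
    using miss_iter_sums[OF assms(1), of y b k]
  proof (rule sums_le[OF _ sums_single[of m], rotated])
    fix j
    show "(if j = m then (real n * y) ^ j / fact j * miss_iter n j (\<lambda>k. b ^ k) k else 0)
       \<le> (real n * y) ^ j / fact j * miss_iter n j (\<lambda>k. b ^ k) k"
      using assms by (auto intro!: mult_nonneg_nonneg divide_nonneg_nonneg miss_iter_nonneg)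
  qed
  moreover have "(real n * y) ^ m > 0" using assms by simp
  ultimately show ?thesis by (simp add: field_simps)
qed

section \<open>Covering probabilities\<close>

text \<open>The recursion makes v a shifted convolution of u with a geometric sequence, and this
  preserves log-concavity. The inductive invariant D says that v / u is nondecreasing,
  cross-multiplied because u may vanish.\<close>

lemma log_concave_convolve:
  fixes u v :: "nat \<Rightarrow> real"
  assumes nn: "\<And>k. 0 \<le> v k" and le: "\<And>k. v k \<le> u k"
    and lc: "\<And>k. u k * u (k + 2) \<le> (u (k + 1))\<^sup>2"
    and v0: "v 0 = 0" and rec: "\<And>k. v (Suc k) = x * v k + y * u k"
    and xy: "0 \<le> x" "0 \<le> y"
  shows "v k * v (k + 2) \<le> (v (k + 1))\<^sup>2"
proof -
  have un: "0 \<le> u k" for k using nn[of k] le[of k] by linarith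
  have D: "v k * u (Suc k) \<le> v (Suc k) * u k" for k
  proof (induction k)
    case 0
    then show ?case using nn un v0 by simp
  next
    case (Suc k)
    have 1: "v k * u (k + 2) \<le> v (Suc k) * u (Suc k)"
    proof (cases "u k = 0")
      case True
      then show ?thesis using nn un le[of k] nn[of k] by simp
    next
      case False
      then have uk: "u k > 0" using un[of k] by simp
      have "v k * (u k * u (k + 2)) \<le> v k * (u (k + 1))\<^sup>2"
        using lc nn by (intro mult_left_mono)
      also have "\<dots> = (v k * u (Suc k)) * u (Suc k)" by (simp add: power2_eq_square)
      also have "\<dots> \<le> (v (Suc k) * u k) * u (Suc k)"
        using Suc un by (intro mult_right_mono)
      finally have "u k * (v k * u (k + 2)) \<le> u k * (v (Suc k) * u (Suc k))"
        by (simp add: mult_ac)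
      then show ?thesis using uk by simp
    qed
    have "v (Suc k) * u (Suc (Suc k)) = x * (v k * u (k + 2)) + y * (u k * u (k + 2))"
      by (simp add: rec[of k] algebra_simps)
    also have "\<dots> \<le> x * (v (Suc k) * u (Suc k)) + y * (u (k + 1))\<^sup>2"
      using 1 lc xy by (intro add_mono mult_left_mono)
    also have "\<dots> = v (Suc (Suc k)) * u (Suc k)"
      by (simp add: rec[of "Suc k"] algebra_simps power2_eq_square)
    finally show ?case .
  qed
  have "v k * v (k + 2) = x * v k * v (Suc k) + y * (v k * u (Suc k))"
    using rec[of "Suc k"] by (simp add: algebra_simps)
  also have "\<dots> \<le> x * v k * v (Suc k) + y * (v (Suc k) * u k)"
    using D xy by (intro add_left_mono mult_left_mono)
  also have "\<dots> = (v (k + 1))\<^sup>2"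
    using rec[of k] by (simp add: algebra_simps power2_eq_square)
  finally show ?thesis .
qed

text \<open>The probability that k prescribed letters all occur among h draws.\<close>

definition cover_prob :: "nat \<Rightarrow> nat \<Rightarrow> nat \<Rightarrow> real" where
  "cover_prob n h k = miss_iter n h (\<lambda>k. 0 ^ k) k"

lemma cover_prob_0_left: "cover_prob n 0 k = 0 ^ k"
  by (simp add: cover_prob_def)

lemma cover_prob_0_right: "cover_prob n h 0 = 1"
  unfolding cover_prob_def by (induction h) auto

lemma cover_prob_Suc:
  "cover_prob n (Suc h) k =
     real k / real n * cover_prob n h (k - 1) + (1 - real k / real n) * cover_prob n h k"
  by (simp add: cover_prob_def)

lemma cover_prob_nonneg: "k \<le> n \<Longrightarrow> 0 \<le> cover_prob n h k"
  unfolding cover_prob_def by (intro miss_iter_nonneg) auto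

lemma cover_prob_antimono:
  assumes "n \<ge> 1" "Suc k \<le> n"
  shows "cover_prob n h (Suc k) \<le> cover_prob n h k"
  using assms(2)
proof (induction h arbitrary: k)
  case 0
  then show ?case by (simp add: cover_prob_0_left)
next
  case (Suc h)
  have "cover_prob n (Suc h) (Suc k) \<le> real (Suc k) / n * cover_prob n h k
      + (1 - real (Suc k) / n) * cover_prob n h k"
    unfolding cover_prob_Suc[of n h "Suc k"] using Suc
    by (intro add_mono mult_left_mono) (auto simp: divide_le_eq)
  also have "\<dots> = real k / n * cover_prob n h k + (1 - real k / n) * cover_prob n h k"
    by (simp add: algebra_simps)
  also have "\<dots> \<le> real k / n * cover_prob n h (k - 1) + (1 - real k / n) * cover_prob n h k"
  proof (cases k)
    case (Suc j)
    then show ?thesis using Suc.IH[of j] Suc.prems by (intro add_mono mult_left_mono) auto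
  qed simp
  finally show ?case by (simp add: cover_prob_Suc)
qed

lemma cover_prob_mono:
  assumes "n \<ge> 1" "k \<le> n"
  shows "cover_prob n h k \<le> cover_prob n (Suc h) k"
proof (cases k)
  case 0
  then show ?thesis by (simp add: cover_prob_0_right)
next
  case (Suc j)
  have "cover_prob n h k = real k / n * cover_prob n h k + (1 - real k / n) * cover_prob n h k"
    by (simp add: algebra_simps)
  also have "\<dots> \<le> real k / n * cover_prob n h (k - 1) + (1 - real k / n) * cover_prob n h k"
    using cover_prob_antimono[of n j h] Suc assms by (intro add_mono mult_left_mono) auto
  finally show ?thesis by (simp add: cover_prob_Suc)
qed

lemma cover_prob_pos:
  assumes "k \<le> n" "k \<le> h"
  shows "0 < cover_prob n h k"
  using assms
proof (induction h arbitrary: k)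
  case (Suc h)
  show ?case
  proof (cases k)
    case (Suc j)
    have "0 < real k / n * cover_prob n h (k - 1)"
      using Suc.IH[of j] Suc.prems Suc by (intro mult_pos_pos) auto
    moreover have "0 \<le> (1 - real k / n) * cover_prob n h k"
      using Suc.prems by (intro mult_nonneg_nonneg cover_prob_nonneg) (auto simp: divide_le_eq)
    ultimately show ?thesis by (simp add: cover_prob_Suc)
  qed (simp add: cover_prob_0_right)
qed (simp add: cover_prob_0_right)

text \<open>The concavity is in the number h of draws. The waiting time for k letters is a sum of
  independent geometric times, and each further letter convolves with one more of them.\<close>

lemma cover_prob_log_concave:
  assumes "n \<ge> 1" "k \<le> n"
  shows "cover_prob n h k * cover_prob n (h + 2) k \<le> (cover_prob n (h + 1) k)\<^sup>2"
  using assms(2)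
proof (induction k arbitrary: h)
  case 0
  then show ?case by (simp add: cover_prob_0_right)
next
  case (Suc k)
  show ?case
    by (rule log_concave_convolve[of _ "\<lambda>h. cover_prob n h k" "1 - real (Suc k) / n" "real (Suc k) / n"])
      (use Suc assms(1) cover_prob_antimono in
        \<open>auto simp: cover_prob_nonneg cover_prob_Suc cover_prob_0_left divide_le_eq\<close>)
qed

text \<open>Log-concavity read as: the growth factor from h to h + 1 draws does not increase with h.
  Cross-multiplied, because the covering probability is 0 while h < k.\<close>

lemma cover_prob_ratio:
  assumes "n \<ge> 1" "k \<le> n"
  shows "cover_prob n (Suc (j + i)) k * cover_prob n j k
     \<le> cover_prob n (j + i) k * cover_prob n (Suc j) k"
proof (induction i)
  case (Suc i)
  let ?p = "\<lambda>h. cover_prob n h k"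
  have nn: "0 \<le> ?p h" for h using assms by (simp add: cover_prob_nonneg)
  have mono: "?p j \<le> ?p (j + i)"
    using lift_Suc_mono_le[of ?p j "j + i"] cover_prob_mono assms by auto
  show ?case
  proof (cases "?p (j + i) = 0")
    case True
    then have "?p j = 0" using mono nn[of j] by simp
    then show ?thesis using nn by simp
  next
    case False
    then have pos: "?p (j + i) > 0" using nn[of "j + i"] by simp
    have "?p (j + i) * ?p (j + i + 2) * ?p j \<le> (?p (j + i + 1))\<^sup>2 * ?p j"
      using cover_prob_log_concave[OF assms] nn by (intro mult_right_mono)
    also have "\<dots> = ?p (j + i + 1) * (?p (Suc (j + i)) * ?p j)" by (simp add: power2_eq_square)
    also have "\<dots> \<le> ?p (j + i + 1) * (?p (j + i) * ?p (Suc j))"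
      using Suc nn by (intro mult_left_mono)
    finally have "?p (j + i) * (?p (j + i + 2) * ?p j) \<le> ?p (j + i) * (?p (j + i + 1) * ?p (Suc j))"
      by (simp add: mult_ac)
    then show ?thesis using pos by simp
  qed
qed simp

text \<open>By log-concavity, \<open>\<rho>\<close> can be tuned so that the term of index \<open>M\<close> is the largest one in the
  generating function of the covering probabilities.\<close>

lemma cover_prob_lower:
  assumes "n \<ge> 1" "n \<le> M"
  obtains \<rho> where "\<rho> > 0" "\<rho> \<le> (real M + 1) / real n"
    "fact M / (real n * \<rho>) ^ M * (exp (real n * \<rho>) * (1 - exp (- \<rho>)) ^ n)
       \<le> (2 * real M + 4) * cover_prob n M n"
proof -
  define p where "p k = cover_prob n k n" for k
  have pM: "p M > 0" "p (Suc M) > 0" and nn: "\<And>k. p k \<ge> 0"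
    using assms by (auto simp: p_def intro!: cover_prob_pos cover_prob_nonneg)
  have ratio: "p (Suc (j + i)) * p j \<le> p (j + i) * p (Suc j)" for i j
    unfolding p_def using assms by (intro cover_prob_ratio) auto
  \<comment> \<open>This s makes the terms M and M + 1 of the series equal: c (k + 1) / c k is s * p
    (k + 1) / ((k + 1) * p k) wherever p k > 0, is nonincreasing in k by \<open>ratio\<close>, and
    equals 1 at k = M.\<close>
  define s where "s = (real M + 1) * p M / p (Suc M)"
  define c where "c k = s ^ k / fact k * p k" for k
  have s: "s > 0" using pM by (simp add: s_def)
  have cn: "c k \<ge> 0" for k using s nn by (simp add: c_def)
  have sS: "s * p (Suc M) = (real M + 1) * p M" using pM by (simp add: s_def)
  have le_sI: "a \<le> s * b" if "a * p (Suc M) \<le> (real M + 1) * p M * b" for a b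
  proof -
    have "a * p (Suc M) \<le> (s * b) * p (Suc M)" using that sS by (simp add: mult_ac)
    then show ?thesis using pM(2) by (rule mult_right_le_imp_le)
  qed
  have s_leI: "s * b \<le> a" if "(real M + 1) * p M * b \<le> a * p (Suc M)" for a b
  proof -
    have "(s * b) * p (Suc M) \<le> a * p (Suc M)" using that sS by (simp add: mult_ac)
    then show ?thesis using pM(2) by (rule mult_right_le_imp_le)
  qed
  have fact_cancel: "s ^ k / fact (Suc k) * ((real k + 1) * x) = s ^ k / fact k * x" for k x
  proof -
    have "fact (Suc k) = (real k + 1) * (fact k :: real)" by simp
    moreover have "real k + 1 \<noteq> 0" by linarith
    ultimately show ?thesis by (simp only: times_divide_eq_left) simp
  qed
  have up: "c k \<le> c (Suc k)" if "k \<le> M" for k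
  proof -
    obtain i where M: "M = k + i" using le_Suc_ex[OF \<open>k \<le> M\<close>] by blast
    have "(real k + 1) * p k \<le> (real M + 1) * p k" using M nn by (intro mult_right_mono) auto
    also have "\<dots> \<le> s * p (Suc k)"
    proof (rule le_sI)
      have "(real M + 1) * (p (Suc M) * p k) \<le> (real M + 1) * (p M * p (Suc k))"
        using ratio[of k i] unfolding M by (rule mult_left_mono) simp
      then show "(real M + 1) * p k * p (Suc M) \<le> (real M + 1) * p M * p (Suc k)"
        by (simp only: mult_ac)
    qed
    finally have "s ^ k / fact (Suc k) * ((real k + 1) * p k) \<le> s ^ k / fact (Suc k) * (s * p (Suc k))"
      using s by (intro mult_left_mono) auto
    then show ?thesis
      unfolding fact_cancel by (simp only: c_def power_Suc mult_ac times_divide_eq_left times_divide_eq_right)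
  qed
  \<comment> \<open>Past M the factorial alone forces decay: beyond 2 M + 2 the terms at least
    halve. The 2 M + 2 head terms plus a geometric tail of sum 2 account for 2 M + 4.\<close>
  have down: "c (Suc k) \<le> (real M + 1) / (real k + 1) * c k" if "M \<le> k" for k
  proof -
    obtain i where k: "k = M + i" using le_Suc_ex[OF \<open>M \<le> k\<close>] by blast
    have "s * p (Suc k) \<le> (real M + 1) * p k"
    proof (rule s_leI)
      have "(real M + 1) * (p (Suc k) * p M) \<le> (real M + 1) * (p k * p (Suc M))"
        using ratio[of M i] unfolding k by (rule mult_left_mono) simp
      then show "(real M + 1) * p M * p (Suc k) \<le> (real M + 1) * p k * p (Suc M)"
        by (simp only: mult_ac)
    qed
    then have "s ^ k / fact (Suc k) * (s * p (Suc k)) \<le> s ^ k / fact (Suc k) * ((real M + 1) * p k)"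
      using s by (intro mult_left_mono) auto
    moreover have "s ^ k / fact (Suc k) * ((real M + 1) * p k) = (real M + 1) / (real k + 1) * c k"
      using fact_cancel[of k "(real M + 1) / (real k + 1) * p k"] by (simp add: c_def mult_ac)
    ultimately show ?thesis
      by (simp only: c_def power_Suc mult_ac times_divide_eq_left times_divide_eq_right)
  qed
  have le1: "c k \<le> c M" if "k \<le> M" for k
    using that
  proof (induction k rule: inc_induct)
    case (step k)
    then show ?case using up[of k] by simp
  qed simp
  have le2: "c (M + i) \<le> c M" for i
  proof (induction i)
    case (Suc i)
    have "c (Suc (M + i)) \<le> (real M + 1) / (real (M + i) + 1) * c (M + i)" by (intro down) simp
    also have "\<dots> \<le> 1 * c (M + i)" by (intro mult_right_mono cn) simp
    finally show ?case using Suc by simp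
  qed simp
  have le: "c k \<le> c M" for k
    using le1[of k] le2[of "k - M"] by (cases "k \<le> M") auto
  have geo: "c (i + (2 * M + 2)) \<le> c M * (1 / 2) ^ i" for i
  proof (induction i)
    case 0
    then show ?case using le by simp
  next
    case (Suc i)
    let ?k = "i + (2 * M + 2)"
    have "c (Suc ?k) \<le> (real M + 1) / (real ?k + 1) * c ?k" by (intro down) simp
    also have "\<dots> \<le> (1 / 2) * c ?k" by (intro mult_right_mono cn) (simp add: field_simps)
    finally show ?case using Suc by simp
  qed
  define \<rho> where "\<rho> = s / n"
  have n\<rho>: "real n * \<rho> = s" using assms by (simp add: \<rho>_def)
  have sums: "c sums (exp (real n * \<rho>) * (1 - exp (- \<rho>)) ^ n)"
    using miss_iter_sums[OF assms(1), of \<rho> 0 n]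
    by (simp add: n\<rho> c_def[abs_def] p_def cover_prob_def)
  have "(\<Sum>k. c k) = (\<Sum>i. c (i + (2 * M + 2))) + (\<Sum>i<2 * M + 2. c i)"
    using sums by (intro suminf_split_initial_segment) (rule sums_summable)
  also have "(\<Sum>i. c (i + (2 * M + 2))) \<le> (\<Sum>i. c M * (1 / 2) ^ i)"
    by (intro suminf_le geo summable_mult summable_geometric summable_ignore_initial_segment
        sums_summable[OF sums]) simp
  also have "(\<Sum>i. c M * (1 / 2) ^ i) = 2 * c M"
    by (subst suminf_mult) (auto simp: suminf_geometric)
  also have "(\<Sum>i<2 * M + 2. c i) \<le> (\<Sum>i<2 * M + 2. c M)"
    by (intro sum_mono le)
  finally have "exp (real n * \<rho>) * (1 - exp (- \<rho>)) ^ n \<le> (2 * real M + 4) * c M"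
    using sums_unique[OF sums] by (simp add: algebra_simps)
  then have "fact M / s ^ M * (exp (real n * \<rho>) * (1 - exp (- \<rho>)) ^ n)
      \<le> fact M / s ^ M * ((2 * real M + 4) * c M)"
    using s by (intro mult_left_mono) auto
  also have "\<dots> = (2 * real M + 4) * p M" using s by (simp add: c_def)
  finally have 3: "fact M / (real n * \<rho>) ^ M * (exp (real n * \<rho>) * (1 - exp (- \<rho>)) ^ n)
      \<le> (2 * real M + 4) * cover_prob n M n"
    by (simp add: n\<rho> p_def)
  \<comment> \<open>Monotonicity in the number of draws caps \<rho>; \<open>pair_prob_le\<close>
    uses the cap to bound exp (- \<rho>) from below.\<close>
  have "p M \<le> p (Suc M)" unfolding p_def using assms by (intro cover_prob_mono) auto
  then have "s \<le> real M + 1" using pM by (simp add: s_def divide_le_eq)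
  then have 2: "\<rho> \<le> (real M + 1) / n" by (simp add: \<rho>_def divide_right_mono)
  show thesis
    using that[OF _ 2 3] s assms by (simp add: \<rho>_def)
qed

section \<open>Two-sided Stirling bounds with polynomial loss\<close>

lemma fact_le_power_exp:
  assumes "n \<ge> 1"
  shows "fact n \<le> exp 1 * real n * (real n / exp 1) ^ n"
  using assms
proof (induction n rule: nat_induct_at_least)
  case (Suc n)
  have n: "real n > 0" using Suc by simp
  \<comment> \<open>Aims at exp 1 \<le> (1 + 1/n)^(n + 1), which is what the induction step
    consumes.\<close>
  have "- ln (1 + 1 / real n) = ln (1 - 1 / real (Suc n))"
    using n by (simp add: ln_div[symmetric] field_simps flip: ln_inverse)
  also have "\<dots> \<le> - (1 / real (Suc n))"
    using ln_le_minus_one[of "1 - 1 / real (Suc n)"] n by simp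
  finally have "1 \<le> real (Suc n) * ln (1 + 1 / real n)" using n by (simp add: field_simps)
  then have "exp 1 \<le> exp (real (Suc n) * ln (1 + 1 / real n))" by simp
  also have "\<dots> = (1 + 1 / real n) ^ Suc n"
    using n by (subst exp_of_nat_mult) (simp add: add_pos_pos)
  finally have e: "exp 1 \<le> (1 + 1 / real n) ^ Suc n" .
  have "fact (Suc n) = real (Suc n) * fact n" by simp
  also have "\<dots> \<le> real (Suc n) * (exp 1 * real n * (real n / exp 1) ^ n)"
    using Suc by (intro mult_left_mono) auto
  also have "\<dots> = real (Suc n) * (real n ^ Suc n / exp 1 ^ n) * exp 1"
    by (simp add: power_divide)
  also have "\<dots> \<le> real (Suc n) * (real n ^ Suc n / exp 1 ^ n) * (1 + 1 / real n) ^ Suc n"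
    using e by (intro mult_left_mono) auto
  also have "\<dots> = exp 1 * real (Suc n) * ((real n * (1 + 1 / real n)) / exp 1) ^ Suc n"
    by (simp only: power_divide power_mult_distrib) simp
  also have "real n * (1 + 1 / real n) = real (Suc n)" using n by (simp add: field_simps)
  finally show ?case .
qed simp

lemma power_exp_le_fact: "(real n / exp 1) ^ n \<le> fact n"
proof -
  have "real n ^ n / fact n \<le> exp (real n)"
    using sums_le[OF _ sums_single[of n "\<lambda>k. real n ^ k / fact k"] exp_converges[of "real n"]]
    by (auto simp: divide_inverse mult.commute)
  then show ?thesis by (simp add: power_divide exp_of_nat_mult[of n 1, simplified] divide_simps mult.commute)
qed

section \<open>Windows and their entries into fullness\<close>

definition full_word :: "nat \<Rightarrow> nat list \<Rightarrow> bool" where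
  "full_word n w \<longleftrightarrow> {1..n} \<subseteq> set w"

definition full_prob :: "nat \<Rightarrow> nat \<Rightarrow> real" where
  "full_prob n M = word_mean n M (\<lambda>w. of_bool (full_word n w))"

text \<open>The probability that two windows of length \<open>M\<close> at distance \<open>h \<le> M\<close> are both full, computed by
  conditioning on their common part.\<close>

definition pair_prob :: "nat \<Rightarrow> nat \<Rightarrow> nat \<Rightarrow> real" where
  "pair_prob n M h =
     word_mean n (M - h) (\<lambda>b. (word_mean n h (\<lambda>a. of_bool (full_word n (a @ b))))\<^sup>2)"

text \<open>By stationarity this is the probability that a window is full and its predecessor is
  not, and equally that its successor is not, so it is also the rate of leaving fullness.\<close>

definition entry_rate :: "nat \<Rightarrow> nat \<Rightarrow> real" where
  "entry_rate n M = full_prob n M - pair_prob n M 1"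

text \<open>Window i holds draws i + 1, ..., i + M. A window that overruns the word is cut short by
  \<open>take\<close>, hence the guards i + M \<le> L in what follows.\<close>

definition full_at :: "nat \<Rightarrow> nat \<Rightarrow> nat \<Rightarrow> nat list \<Rightarrow> bool" where
  "full_at n M i w \<longleftrightarrow> full_word n (take M (drop i w))"

definition enters_at :: "nat \<Rightarrow> nat \<Rightarrow> nat \<Rightarrow> nat list \<Rightarrow> bool" where
  "enters_at n M i w \<longleftrightarrow> \<not> full_at n M i w \<and> full_at n M (Suc i) w"

lemma of_bool_full_word:
  "of_bool (full_word n (w @ b)) = (0::real) ^ card (({1..n} - set b) - set w)"
proof -
  have "full_word n (w @ b) \<longleftrightarrow> ({1..n} - set b) - set w = {}"
    by (auto simp: full_word_def)
  moreover have "finite (({1..n} - set b) - set w)" by simp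
  ultimately show ?thesis by (simp add: of_bool_def power_0_left)
qed

lemma word_mean_full_word:
  assumes "n \<ge> 1"
  shows "word_mean n h (\<lambda>a. of_bool (full_word n (a @ b))) = cover_prob n h (card ({1..n} - set b))"
  unfolding of_bool_full_word cover_prob_def
  using word_mean_miss[OF assms, of "{1..n} - set b" h "\<lambda>k. 0 ^ k"] by simp

lemma full_prob_eq:
  assumes "n \<ge> 1"
  shows "full_prob n M = cover_prob n M n"
  using word_mean_full_word[OF assms, of M "[]"] by (simp add: full_prob_def)

lemma pair_prob_eq:
  assumes "n \<ge> 1"
  shows "pair_prob n M h = miss_iter n (M - h) (\<lambda>k. (cover_prob n h k)\<^sup>2) n"
  using word_mean_miss[OF assms, of "{1..n}" "M - h" "\<lambda>k. (cover_prob n h k)\<^sup>2"]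
  by (simp add: pair_prob_def word_mean_full_word[OF assms])

lemma pair_prob_nonneg: "0 \<le> pair_prob n M h"
  unfolding pair_prob_def by (intro word_mean_nonneg) simp

text \<open>A larger lag takes one letter d away from the common part. The conditional covering
  probability given the shorter part is the average over d of the former one, and averaging before
  squaring can only lower the mean square.\<close>

lemma pair_prob_antimono_step:
  assumes "n \<ge> 1" "h < M"
  shows "pair_prob n M (Suc h) \<le> pair_prob n M h"
proof -
  define g where "g b = word_mean n h (\<lambda>a. of_bool (full_word n (a @ b)))" for b
  let ?m = "M - Suc h"
  have *: "word_mean n (Suc h) (\<lambda>a. of_bool (full_word n (a @ b))) = word_mean n 1 (\<lambda>d. g (d @ b))" for b
  proof -
    have "word_mean n (1 + h) (\<lambda>a. of_bool (full_word n (a @ b)))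
        = word_mean n 1 (\<lambda>d. word_mean n h (\<lambda>a. of_bool (full_word n ((d @ a) @ b))))"
      by (rule word_mean_append)
    \<comment> \<open>Fullness depends only on the set of letters, so d may be moved next to
      b.\<close>
    also have "\<dots> = word_mean n 1 (\<lambda>d. g (d @ b))"
      unfolding g_def full_word_def by (simp only: set_append Un_ac)
    finally show ?thesis by simp
  qed
  have "pair_prob n M (Suc h) = word_mean n ?m (\<lambda>b. (word_mean n 1 (\<lambda>d. g (d @ b)))\<^sup>2)"
    unfolding pair_prob_def * ..
  also have "\<dots> \<le> word_mean n ?m (\<lambda>b. word_mean n 1 (\<lambda>d. (g (d @ b))\<^sup>2))"
    by (intro word_mean_mono word_mean_square_le assms)
  also have "\<dots> = word_mean n 1 (\<lambda>d. word_mean n ?m (\<lambda>b. (g (d @ b))\<^sup>2))"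
    by (rule word_mean_swap)
  also have "\<dots> = word_mean n (1 + ?m) (\<lambda>b. (g b)\<^sup>2)"
    by (rule word_mean_append[symmetric])
  also have "1 + ?m = M - h" using assms by simp
  finally show ?thesis by (simp add: pair_prob_def g_def)
qed

lemma pair_prob_antimono:
  assumes "n \<ge> 1" "h \<le> h'" "h' \<le> M"
  shows "pair_prob n M h' \<le> pair_prob n M h"
  using assms(2,3)
proof (induction h' rule: dec_induct)
  case (step k)
  then show ?case using pair_prob_antimono_step[OF assms(1), of k M] by simp
qed simp

section \<open>Stationarity and pair correlations of entries, by lag\<close>

lemma word_mean_full_at:
  assumes "n \<ge> 1" "i + M \<le> L"
  shows "word_mean n L (\<lambda>w. of_bool (full_at n M i w)) = full_prob n M"
  unfolding full_at_def full_prob_def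
  using word_mean_factor[OF assms, of "\<lambda>v. of_bool (full_word n v)"] by simp

text \<open>The windows are a @ b and b @ c. Given the shared b, the outer parts are independent
  with the same law, so the conditional probability that both windows are full is a square.\<close>

lemma word_mean_full_at_pair:
  assumes "n \<ge> 1" "h \<le> M" "i + h + M \<le> L"
  shows "word_mean n L (\<lambda>w. of_bool (full_at n M i w) * of_bool (full_at n M (i + h) w)) = pair_prob n M h"
proof -
  let ?f = "\<lambda>v. of_bool (full_word n (take M v)) * of_bool (full_word n (take M (drop h v))) :: real"
  have "word_mean n L (\<lambda>w. of_bool (full_at n M i w) * of_bool (full_at n M (i + h) w))
     = word_mean n L (\<lambda>w. ?f (take (M + h) (drop i w)))"
    unfolding full_at_def by (simp add: drop_take add.commute)
  also have "\<dots> = word_mean n (M + h) ?f"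
    using assms by (intro word_mean_factor) auto
  also have "M + h = h + ((M - h) + h)" using assms by simp
  also have "word_mean n \<dots> ?f = word_mean n h (\<lambda>a. word_mean n (M - h) (\<lambda>b.
      word_mean n h (\<lambda>c. of_bool (full_word n (a @ b)) * of_bool (full_word n (c @ b)))))"
    unfolding word_mean_append
  proof (intro word_mean_cong)
    fix a b c :: "nat list"
    assume "length a = h" "length b = M - h" "length c = h"
    then have "take M (a @ b @ c) = a @ b" "take M (drop h (a @ b @ c)) = b @ c"
      using assms by auto
    then show "?f (a @ b @ c) = of_bool (full_word n (a @ b)) * of_bool (full_word n (c @ b))"
      by (simp add: full_word_def Un_commute)
  qed
  also have "\<dots> = word_mean n (M - h) (\<lambda>b. word_mean n h (\<lambda>a.
      word_mean n h (\<lambda>c. of_bool (full_word n (a @ b)) * of_bool (full_word n (c @ b)))))"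
    by (rule word_mean_swap)
  also have "\<dots> = pair_prob n M h"
    unfolding word_mean_prod pair_prob_def power2_eq_square ..
  finally show ?thesis .
qed

lemma word_mean_enters_at:
  assumes "n \<ge> 1" "M \<ge> 1" "i + M < L"
  shows "word_mean n L (\<lambda>w. of_bool (enters_at n M i w)) = entry_rate n M"
proof -
  have "word_mean n L (\<lambda>w. of_bool (enters_at n M i w)) = word_mean n L (\<lambda>w.
     of_bool (full_at n M (Suc i) w) - of_bool (full_at n M i w) * of_bool (full_at n M (i + 1) w))"
    by (intro word_mean_cong) (auto simp: enters_at_def)
  also have "\<dots> = full_prob n M - pair_prob n M 1"
    unfolding word_mean_diff using assms
    by (intro arg_cong2[of _ _ _ _ "(-)"] word_mean_full_at word_mean_full_at_pair) auto
  finally show ?thesis by (simp add: entry_rate_def)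
qed

lemma entry_rate_nonneg:
  assumes "n \<ge> 1" "M \<ge> 1"
  shows "0 \<le> entry_rate n M"
  using word_mean_nonneg[of "M + 1" n "\<lambda>w. of_bool (enters_at n M 0 w)"]
    word_mean_enters_at[OF assms, of 0 "M + 1"] by simp

text \<open>The drop is at most the probability that windows 0 and h are full but h + 1 is not. Then
  fullness is left at h, and exits have the same rate as entries.\<close>

lemma pair_prob_diff_le:
  assumes "n \<ge> 1" "h < M"
  shows "pair_prob n M h - pair_prob n M (Suc h) \<le> entry_rate n M"
proof -
  let ?L = "Suc h + M"
  let ?F = "\<lambda>i w. of_bool (full_at n M i w) :: real"
  have "pair_prob n M h - pair_prob n M (Suc h)
      = word_mean n ?L (\<lambda>w. ?F 0 w * ?F (0 + h) w - ?F 0 w * ?F (0 + Suc h) w)"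
    unfolding word_mean_diff using assms
    by (intro arg_cong2[of _ _ _ _ "(-)"] word_mean_full_at_pair[symmetric]) auto
  also have "\<dots> \<le> word_mean n ?L (\<lambda>w. ?F h w - ?F h w * ?F (h + 1) w)"
    by (intro word_mean_mono) auto
  also have "\<dots> = entry_rate n M"
    unfolding word_mean_diff entry_rate_def using assms
    by (intro arg_cong2[of _ _ _ _ "(-)"] word_mean_full_at word_mean_full_at_pair) auto
  finally show ?thesis .
qed

lemma pair_prob_0: "n \<ge> 1 \<Longrightarrow> pair_prob n M 0 = full_prob n M"
  unfolding pair_prob_def full_prob_def word_mean.simps(1)
  by (simp only: append_Nil diff_zero, intro word_mean_cong) simp

text \<open>Telescoped drops. Once the pair probability is negligible, this bounds
  \<open>full_prob\<close> by a multiple of the entry rate.\<close>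

lemma full_prob_le_pair_prob:
  assumes "n \<ge> 1" "h \<le> M"
  shows "full_prob n M \<le> pair_prob n M h + real h * entry_rate n M"
  using assms(2)
proof (induction h)
  case 0
  then show ?case using pair_prob_0[OF assms(1)] by simp
next
  case (Suc h)
  then show ?case using pair_prob_diff_le[OF assms(1), of h M] by (simp add: algebra_simps)
qed

lemma enters_at_take:
  assumes "i + M < k"
  shows "enters_at n M i (take k w) = enters_at n M i w"
  using assms by (simp add: enters_at_def full_at_def drop_take min_def)

lemma enters_at_drop:
  "enters_at n M i (u @ v) = enters_at n M (i - length u) v" if "length u \<le> i"
  using that by (simp add: enters_at_def full_at_def Suc_diff_le)

text \<open>Given the past, an entry at j asks the last letter to be the one type lacking among the
  M - 1 letters kept from window j; this costs the factor 1/n.\<close>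

lemma enters_at_near:
  assumes "n \<ge> 1" "M \<ge> 1" "i < j" "j + M < L"
  shows "word_mean n L (\<lambda>w. of_bool (enters_at n M i w) * of_bool (enters_at n M j w))
     \<le> entry_rate n M / real n"
proof -
  let ?f = "\<lambda>w. of_bool (enters_at n M i w) * of_bool (enters_at n M j w) :: real"
  have one: "word_mean n 1 (\<lambda>v. of_bool (enters_at n M j (u @ v))) \<le> 1 / real n"
    if "length u = j + M" for u
  proof -
    \<comment> \<open>If two different last letters both completed the kept part ?x, it would be
      full by itself, and window j with it.\<close>
    have *: "c = d" if c: "enters_at n M j (u @ [c])" and d: "enters_at n M j (u @ [d])" for c d
    proof (rule ccontr)
      assume "c \<noteq> d"
      let ?x = "drop (Suc j) u"
      have "{1..n} \<subseteq> insert c (set ?x)" "{1..n} \<subseteq> insert d (set ?x)"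
        using c d \<open>length u = j + M\<close> assms(2) by (auto simp: enters_at_def full_at_def full_word_def)
      then have "{1..n} \<subseteq> set ?x" using \<open>c \<noteq> d\<close> by blast
      also have "\<dots> \<subseteq> set (drop j u)" by (intro set_drop_subset_set_drop) simp
      finally show False
        using c \<open>length u = j + M\<close> by (simp add: enters_at_def full_at_def full_word_def)
    qed
    have "(\<Sum>c=1..n. of_bool (enters_at n M j (u @ [c])) :: real) \<le> 1"
    proof (cases "\<exists>c. enters_at n M j (u @ [c])")
      case True
      then obtain c where c: "enters_at n M j (u @ [c])" by blast
      have "(\<Sum>d=1..n. of_bool (enters_at n M j (u @ [d])) :: real) \<le> (\<Sum>d=1..n. if d = c then 1 else 0)"
        using * c by (intro sum_mono) auto
      also have "\<dots> \<le> 1" by simp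
      finally show ?thesis .
    qed simp
    then show ?thesis by (simp add: divide_right_mono)
  qed
  have "word_mean n L ?f = word_mean n L (\<lambda>w. ?f (take (j + M + 1) (drop 0 w)))"
    using assms by (simp add: enters_at_take)
  also have "\<dots> = word_mean n (j + M + 1) ?f"
    using assms by (intro word_mean_factor) auto
  also have "\<dots> = word_mean n (j + M) (\<lambda>u. of_bool (enters_at n M i u)
      * word_mean n 1 (\<lambda>v. of_bool (enters_at n M j (u @ v))))"
    unfolding word_mean_append[of n "j + M" 1] word_mean_cmult[symmetric]
  proof (intro word_mean_cong)
    fix u v :: "nat list"
    assume "length u = j + M"
    then have "enters_at n M i (u @ v) = enters_at n M i u"
      using enters_at_take[of i M "j + M" n "u @ v"] assms by simp
    then show "?f (u @ v) = of_bool (enters_at n M i u) * of_bool (enters_at n M j (u @ v))"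
      by simp
  qed
  also have "\<dots> \<le> word_mean n (j + M) (\<lambda>u. of_bool (enters_at n M i u) * (1 / real n))"
    by (intro word_mean_mono mult_left_mono one) auto
  also have "\<dots> = entry_rate n M / n"
    unfolding word_mean_multc using assms by (subst word_mean_enters_at) auto
  finally show ?thesis .
qed

text \<open>The two entries make windows i + 1 and j + 1 full, and these are again j - i
  apart.\<close>

lemma enters_at_middle:
  assumes "n \<ge> 1" "M \<ge> 1" "h \<le> M" "i + h \<le> j" "j \<le> i + M" "j + M < L"
  shows "word_mean n L (\<lambda>w. of_bool (enters_at n M i w) * of_bool (enters_at n M j w))
     \<le> pair_prob n M h"
proof -
  have "word_mean n L (\<lambda>w. of_bool (enters_at n M i w) * of_bool (enters_at n M j w))
     \<le> word_mean n L (\<lambda>w. of_bool (full_at n M (Suc i) w) * of_bool (full_at n M (Suc i + (j - i)) w))"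
    using assms by (intro word_mean_mono) (auto simp: enters_at_def)
  also have "\<dots> = pair_prob n M (j - i)"
    using assms by (intro word_mean_full_at_pair) auto
  also have "\<dots> \<le> pair_prob n M h"
    using assms by (intro pair_prob_antimono) auto
  finally show ?thesis .
qed

text \<open>An entry at i is decided by draws i + 1, ..., i + M + 1, one more than a window; for j >
  i + M the two stretches are disjoint.\<close>

lemma enters_at_far:
  assumes "n \<ge> 1" "M \<ge> 1" "i + M < j" "j + M < L"
  shows "word_mean n L (\<lambda>w. of_bool (enters_at n M i w) * of_bool (enters_at n M j w))
     = (entry_rate n M)\<^sup>2"
proof -
  let ?e = "\<lambda>i w. of_bool (enters_at n M i w) :: real"
  define a where "a = i + M + 1"
  have L: "L = a + (L - a)" using assms by (simp add: a_def)
  have "word_mean n L (\<lambda>w. ?e i w * ?e j w)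
     = word_mean n a (\<lambda>u. word_mean n (L - a) (\<lambda>v. ?e i (u @ v) * ?e j (u @ v)))"
    by (subst L) (rule word_mean_append)
  also have "\<dots> = word_mean n a (\<lambda>u. word_mean n (L - a) (\<lambda>v. ?e i u * ?e (j - a) v))"
  proof (intro word_mean_cong)
    fix u v :: "nat list"
    assume "length u = a"
    then show "?e i (u @ v) * ?e j (u @ v) = ?e i u * ?e (j - a) v"
      using enters_at_take[of i M a n "u @ v"] enters_at_drop[of u j n M v] assms by (simp add: a_def)
  qed
  also have "\<dots> = (entry_rate n M)\<^sup>2"
    unfolding word_mean_prod power2_eq_square using assms
    by (intro arg_cong2[of _ _ _ _ "(*)"] word_mean_enters_at) (auto simp: a_def)
  finally show ?thesis .
qed

section \<open>Survival probabilities: blocks without a full window\<close>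

definition no_full :: "nat \<Rightarrow> nat \<Rightarrow> nat list \<Rightarrow> bool" where
  "no_full n M w \<longleftrightarrow> (\<forall>i. i + M \<le> length w \<longrightarrow> \<not> full_at n M i w)"

definition survival :: "nat \<Rightarrow> nat \<Rightarrow> nat \<Rightarrow> real" where
  "survival n M L = word_mean n L (\<lambda>w. of_bool (no_full n M w))"

lemma survival_nonneg: "0 \<le> survival n M L"
  unfolding survival_def by (intro word_mean_nonneg) simp

lemma survival_le_1: "n \<ge> 1 \<Longrightarrow> survival n M L \<le> 1"
  using word_mean_mono[of L n "\<lambda>w. of_bool (no_full n M w)" "\<lambda>_. 1"]
  by (simp add: survival_def word_mean_const)

lemma no_full_append:
  assumes "no_full n M (u @ v)"
  shows "no_full n M u" "no_full n M v"
proof -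
  show "no_full n M u"
    unfolding no_full_def
  proof safe
    fix i
    assume "i + M \<le> length u" "full_at n M i u"
    then have "full_at n M i (u @ v)" by (simp add: full_at_def)
    then show False using assms \<open>i + M \<le> length u\<close> by (simp add: no_full_def)
  qed
  show "no_full n M v"
    unfolding no_full_def
  proof safe
    fix i
    assume "i + M \<le> length v" "full_at n M i v"
    then have "full_at n M (length u + i) (u @ v)" by (simp add: full_at_def)
    then show False using assms \<open>i + M \<le> length v\<close> by (simp add: no_full_def)
  qed
qed

lemma survival_add_le:
  assumes "n \<ge> 1"
  shows "survival n M (a + b) \<le> survival n M a * survival n M b"
  unfolding survival_def word_mean_append word_mean_prod[symmetric]
  by (intro word_mean_mono) (auto dest: no_full_append)

lemma survival_antimono:
  assumes "n \<ge> 1" "a \<le> b"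
  shows "survival n M b \<le> survival n M a"
proof -
  have "survival n M (a + (b - a)) \<le> survival n M a * survival n M (b - a)"
    by (intro survival_add_le assms)
  also have "\<dots> \<le> survival n M a * 1"
    by (intro mult_left_mono survival_nonneg survival_le_1 assms)
  finally show ?thesis using assms by simp
qed

lemma full_at_entered:
  assumes "full_at n M j w" "\<not> full_at n M i w" "i \<le> j"
  obtains k where "i \<le> k" "k < j" "enters_at n M k w"
proof -
  have "full_at n M j w \<Longrightarrow> \<exists>k. i \<le> k \<and> k < j \<and> enters_at n M k w"
    using assms(3)
  proof (induction j rule: dec_induct)
    case base
    then show ?case using assms(2) by simp
  next
    case (step j)
    then show ?case by (cases "full_at n M j w") (auto simp: enters_at_def less_Suc_eq)
  qed
  then show thesis using assms that by blast
qed

text \<open>Only windows straddling the cut are lost. If neither side contains a full window, window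
  a - M is not full, so a full straddling window is preceded by an entry at one of the M times a -
  M, ..., a - 1.\<close>

lemma survival_add_ge:
  assumes "n \<ge> 1" "M \<ge> 1" "M \<le> a" "M \<le> b"
  shows "survival n M a * survival n M b - real M * entry_rate n M \<le> survival n M (a + b)"
proof -
  let ?e = "\<lambda>k w. of_bool (enters_at n M k w) :: real"
  have "survival n M a * survival n M b
     = word_mean n a (\<lambda>u. word_mean n b (\<lambda>v. of_bool (no_full n M u) * of_bool (no_full n M v)))"
    by (simp add: survival_def word_mean_prod)
  also have "\<dots> \<le> word_mean n a (\<lambda>u. word_mean n b (\<lambda>v. of_bool (no_full n M (u @ v))
      + (\<Sum>k=a - M..<a. ?e k (u @ v))))"
  proof (intro word_mean_mono)
    fix u v :: "nat list"
    assume u: "length u = a" and v: "length v = b"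
    have nn: "0 \<le> (\<Sum>k=a - M..<a. ?e k (u @ v))" by (intro sum_nonneg) simp
    show "of_bool (no_full n M u) * of_bool (no_full n M v) \<le> of_bool (no_full n M (u @ v))
      + (\<Sum>k=a - M..<a. ?e k (u @ v))"
    proof (cases "no_full n M u \<and> no_full n M v \<and> \<not> no_full n M (u @ v)")
      case True
      then obtain i where i: "i + M \<le> a + b" "full_at n M i (u @ v)"
        using u v by (auto simp: no_full_def)
      have 1: "\<not> full_at n M k (u @ v)" if "k + M \<le> a" for k
        using True that u by (auto simp: no_full_def full_at_def)
      have ia: "i < a"
      proof (rule ccontr)
        assume "\<not> i < a"
        then have "full_at n M (i - a) v" using i u by (simp add: full_at_def)
        then show False using True i v \<open>\<not> i < a\<close> by (auto simp: no_full_def)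
      qed
      have "\<not> i + M \<le> a" using 1[of i] i by blast
      then have "a - M \<le> i" by linarith
      moreover have "\<not> full_at n M (a - M) (u @ v)" using 1[of "a - M"] assms by simp
      ultimately obtain k where "a - M \<le> k" "k < i" "enters_at n M k (u @ v)"
        using i(2) by (blast elim: full_at_entered)
      then have "1 \<le> (\<Sum>k=a - M..<a. ?e k (u @ v))"
        using member_le_sum[of k "{a - M..<a}" "\<lambda>k. ?e k (u @ v)"] ia by auto
      then show ?thesis using True by simp
    qed (use nn in auto)
  qed
  also have "\<dots> = word_mean n (a + b) (\<lambda>w. of_bool (no_full n M w) + (\<Sum>k=a - M..<a. ?e k w))"
    by (rule word_mean_append[symmetric])
  also have "\<dots> = survival n M (a + b) + (\<Sum>k=a - M..<a. word_mean n (a + b) (?e k))"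
    by (simp only: word_mean_add survival_def word_mean_sum)
  also have "(\<Sum>k=a - M..<a. word_mean n (a + b) (?e k)) \<le> (\<Sum>k=a - M..<a. entry_rate n M)"
  proof (intro sum_mono)
    fix k assume "k \<in> {a - M..<a}"
    then show "word_mean n (a + b) (?e k) \<le> entry_rate n M"
      using assms by (subst word_mean_enters_at) auto
  qed
  finally show ?thesis using assms by simp
qed

text \<open>Either window 0 is already full, which does not count as an entry, or fullness is
  entered at one of the L - M times.\<close>

lemma failure_le:
  assumes "n \<ge> 1" "M \<ge> 1" "M \<le> L"
  shows "1 - survival n M L \<le> full_prob n M + real L * entry_rate n M"
proof -
  let ?e = "\<lambda>k w. of_bool (enters_at n M k w) :: real"
  have "1 - survival n M L = word_mean n L (\<lambda>w. 1 - of_bool (no_full n M w))"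
    by (simp add: survival_def word_mean_diff word_mean_const[OF assms(1)])
  also have "\<dots> \<le> word_mean n L (\<lambda>w. of_bool (full_at n M 0 w) + (\<Sum>k<L - M. ?e k w))"
  proof (intro word_mean_mono)
    fix w :: "nat list" assume L: "length w = L"
    have nn: "0 \<le> (\<Sum>k<L - M. ?e k w)" by (intro sum_nonneg) simp
    show "1 - of_bool (no_full n M w) \<le> of_bool (full_at n M 0 w) + (\<Sum>k<L - M. ?e k w)"
    proof (cases "no_full n M w \<or> full_at n M 0 w")
      case False
      then obtain i where i: "i + M \<le> L" "full_at n M i w" using L by (auto simp: no_full_def)
      moreover have "\<not> full_at n M 0 w" using False by blast
      ultimately obtain k where "k < i" "enters_at n M k w" by (blast elim: full_at_entered)
      then have "1 \<le> (\<Sum>k<L - M. ?e k w)"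
        using member_le_sum[of k "{..<L - M}" "\<lambda>k. ?e k w"] i by auto
      then show ?thesis using False by simp
    qed (use nn in auto)
  qed
  also have "\<dots> = full_prob n M + (\<Sum>k<L - M. word_mean n L (?e k))"
    unfolding word_mean_add word_mean_sum using assms by (subst word_mean_full_at) auto
  also have "(\<Sum>k<L - M. word_mean n L (?e k)) = (\<Sum>k<L - M. entry_rate n M)"
    using assms by (intro sum.cong word_mean_enters_at) auto
  also have "\<dots> \<le> real L * entry_rate n M"
    using entry_rate_nonneg[OF assms(1,2)] by (auto intro!: mult_right_mono)
  finally show ?thesis by simp
qed

lemma bonferroni_of_bool:
  "(\<Sum>j<K. of_bool (b j)) - (\<Sum>j<K. \<Sum>i<j. of_bool (b i) * of_bool (b j))
     \<le> (of_bool (\<exists>i<K. b i) :: real)" for K :: nat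
proof (induction K)
  case (Suc K)
  have "(\<exists>i<Suc K. b i) \<longleftrightarrow> (\<exists>i<K. b i) \<or> b K" by (auto simp: less_Suc_eq)
  moreover have "(\<Sum>i<K. of_bool (b i) * of_bool (b K)) = of_bool (b K) * (\<Sum>i<K. of_bool (b i) :: real)"
    by (simp add: sum_distrib_left mult.commute)
  moreover have "1 \<le> (\<Sum>i<K. of_bool (b i) :: real)" if "\<exists>i<K. b i"
    using that member_le_sum[of _ "{..<K}" "\<lambda>i. of_bool (b i) :: real"] by force
  moreover have "0 \<le> (\<Sum>i<K. of_bool (b i) :: real)" by (intro sum_nonneg) simp
  ultimately show ?case using Suc.IH by (cases "b K"; cases "\<exists>i<K. b i") auto
qed simp

text \<open>Second-order Bonferroni over the L - M possible entry times. For fixed j the earlier i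
  are sorted by lag: below H, from H to M, and beyond M, where the entries are independent.\<close>

lemma failure_ge:
  assumes "n \<ge> 1" "M \<ge> 1" "M \<le> L" "H \<le> M"
  shows "real (L - M) * (entry_rate n M - (real H * (entry_rate n M / real n)
     + real (M + 1) * pair_prob n M H + real L * (entry_rate n M)\<^sup>2)) \<le> 1 - survival n M L"
proof -
  let ?e = "\<lambda>k w. of_bool (enters_at n M k w) :: real"
  define r where "r = entry_rate n M"
  define \<delta> where "\<delta> = real H * (r / real n) + real (M + 1) * pair_prob n M H + real L * r\<^sup>2"
  have r: "r \<ge> 0" using entry_rate_nonneg assms by (simp add: r_def)
  have pn: "pair_prob n M H \<ge> 0" by (rule pair_prob_nonneg)
  define K where "K = L - M"
  have pairs: "(\<Sum>i<j. word_mean n L (\<lambda>w. ?e i w * ?e j w)) \<le> \<delta>" if "j < K" for j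
  proof -
    have "(\<Sum>i<j. word_mean n L (\<lambda>w. ?e i w * ?e j w)) \<le>
      (\<Sum>i<j. (if j < i + H then r / n else 0) + (if j \<le> i + M then pair_prob n M H else 0) + r\<^sup>2)"
    proof (intro sum_mono)
      fix i assume i: "i \<in> {..<j}"
      consider "j < i + H" | "i + H \<le> j" "j \<le> i + M" | "i + H \<le> j" "i + M < j" by linarith
      then show "word_mean n L (\<lambda>w. ?e i w * ?e j w) \<le>
        (if j < i + H then r / n else 0) + (if j \<le> i + M then pair_prob n M H else 0) + r\<^sup>2"
      proof cases
        case 1
        have "word_mean n L (\<lambda>w. ?e i w * ?e j w) \<le> r / n"
          unfolding r_def using i assms that by (intro enters_at_near) (auto simp: K_def)
        then show ?thesis using 1 pn by (auto intro: add_increasing2)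
      next
        case 2
        have "word_mean n L (\<lambda>w. ?e i w * ?e j w) \<le> pair_prob n M H"
          using i assms that 2 by (intro enters_at_middle[of n M H i j]) (auto simp: K_def)
        then show ?thesis using 2 by (auto intro: add_increasing2)
      next
        case 3
        then show ?thesis
          using enters_at_far[of n M i j L] i assms that by (simp add: K_def r_def)
      qed
    qed
    also have "\<dots> = (\<Sum>i<j. if j < i + H then r / n else 0)
        + (\<Sum>i<j. if j \<le> i + M then pair_prob n M H else 0) + real j * r\<^sup>2"
      by (simp add: sum.distrib)
    also have "(\<Sum>i<j. if j < i + H then r / n else 0) = real (card {i\<in>{..<j}. j < i + H}) * (r / n)"
      by (simp add: sum.If_cases Int_def)
    also have "(\<Sum>i<j. if j \<le> i + M then pair_prob n M H else 0)
        = real (card {i\<in>{..<j}. j \<le> i + M}) * pair_prob n M H"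
      by (simp add: sum.If_cases Int_def)
    also have "card {i\<in>{..<j}. j < i + H} \<le> card {j - H..<j}"
      by (intro card_mono) auto
    also have "card {i\<in>{..<j}. j \<le> i + M} \<le> card {j - M..<j}"
      by (intro card_mono) auto
    finally have "(\<Sum>i<j. word_mean n L (\<lambda>w. ?e i w * ?e j w)) \<le>
      real (card {j - H..<j}) * (r / n) + real (card {j - M..<j}) * pair_prob n M H + real j * r\<^sup>2"
      using r pn by (simp add: mult_right_mono divide_right_mono)
    also have "\<dots> \<le> \<delta>"
      unfolding \<delta>_def using r pn that by (intro add_mono mult_right_mono) (auto simp: K_def)
    finally show ?thesis .
  qed
  have "real K * r - real K * \<delta> \<le> (\<Sum>j<K. r) - (\<Sum>j<K. \<Sum>i<j. word_mean n L (\<lambda>w. ?e i w * ?e j w))"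
    using sum_mono[of "{..<K}" "\<lambda>j. \<Sum>i<j. word_mean n L (\<lambda>w. ?e i w * ?e j w)" "\<lambda>_. \<delta>"] pairs by auto
  also have "(\<Sum>j<K. r) = (\<Sum>j<K. word_mean n L (?e j))"
    unfolding r_def using assms by (intro sum.cong word_mean_enters_at[symmetric]) (auto simp: K_def)
  also have "\<dots> - (\<Sum>j<K. \<Sum>i<j. word_mean n L (\<lambda>w. ?e i w * ?e j w))
      = word_mean n L (\<lambda>w. (\<Sum>j<K. ?e j w) - (\<Sum>j<K. \<Sum>i<j. ?e i w * ?e j w))"
    by (simp only: word_mean_diff word_mean_sum)
  also have "\<dots> \<le> word_mean n L (\<lambda>w. 1 - of_bool (no_full n M w))"
  proof (intro word_mean_mono)
    fix w :: "nat list" assume L: "length w = L"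
    have "of_bool (\<exists>i<K. enters_at n M i w) \<le> (1 - of_bool (no_full n M w) :: real)"
    proof (cases "\<exists>i<K. enters_at n M i w")
      case True
      then obtain i where i: "i < K" "full_at n M (Suc i) w" by (auto simp: enters_at_def)
      then have "Suc i + M \<le> length w" using L by (simp add: K_def)
      then have "\<not> no_full n M w" using i unfolding no_full_def by blast
      then show ?thesis by simp
    qed simp
    then show "(\<Sum>j<K. ?e j w) - (\<Sum>j<K. \<Sum>i<j. ?e i w * ?e j w) \<le> 1 - of_bool (no_full n M w)"
      using bonferroni_of_bool[where b = "\<lambda>i. enters_at n M i w" and K = K] by linarith
  qed
  also have "\<dots> = 1 - survival n M L"
    by (simp add: survival_def word_mean_diff word_mean_const[OF assms(1)])
  finally show ?thesis by (simp add: \<delta>_def r_def K_def algebra_simps)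
qed

section \<open>Exact entry rate and pair probabilities\<close>

text \<open>There are S(m, j) * n! / (n - j)! words with exactly j distinct letters; appending a
  last letter, old or new, mirrors the Stirling recursion.\<close>

lemma word_mean_card_set:
  assumes "n \<ge> 1" "j \<le> n"
  shows "word_mean n m (\<lambda>w. of_bool (card (set w) = j))
    = real (Stirling m j) * (fact n / fact (n - j)) / real n ^ m"
  using assms(2)
proof (induction m arbitrary: j)
  case 0
  then show ?case by (cases j) auto
next
  case (Suc m)
  let ?c = "\<lambda>j w. of_bool (card (set w) = j) :: real"
  show ?case
  proof (cases j)
    case 0
    have "word_mean n (Suc m) (?c 0) = word_mean n (Suc m) (\<lambda>w. 0)"
      by (intro word_mean_cong) auto
    then show ?thesis using 0 by (simp only: word_mean_zero) simp
  next
    case (Suc i)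
    have i: "i < n" using Suc Suc.prems by simp
    have one: "word_mean n 1 (\<lambda>v. ?c j (u @ v)) = ?c j u * (real j / n) + ?c i u * ((real n - real i) / n)"
      if u: "set u \<subseteq> {1..n}" for u
    proof -
      have fin: "finite (set u)" by simp
      have "(\<Sum>c=1..n. ?c j (u @ [c])) = (\<Sum>c\<in>set u. ?c j u) + (\<Sum>c\<in>{1..n} - set u. ?c i u)"
        using u Suc by (subst sum.subset_diff[OF u]) (auto simp: insert_absorb add.commute intro!: sum.cong arg_cong2[of _ _ _ _ "(+)"])
      also have "\<dots> = ?c j u * real j + ?c i u * (real n - real i)"
        using u i by (auto simp: card_Diff_subset of_nat_diff)
      finally show ?thesis by (simp add: add_divide_distrib)
    qed
    have "word_mean n (m + 1) (?c j) = word_mean n m (\<lambda>u. word_mean n 1 (\<lambda>v. ?c j (u @ v)))"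
      by (rule word_mean_append)
    also have "\<dots> = word_mean n m (\<lambda>u. ?c j u * (real j / n) + ?c i u * ((real n - real i) / n))"
      by (intro word_mean_cong one)
    also have "\<dots> = word_mean n m (?c j) * (real j / n) + word_mean n m (?c i) * ((real n - real i) / n)"
      by (simp only: word_mean_add word_mean_multc)
    also have "\<dots> = real (Stirling m j) * (fact n / fact (n - j)) / real n ^ m * (real j / n)
        + real (Stirling m i) * (fact n / fact (n - i)) / real n ^ m * ((real n - real i) / n)"
      using Suc.IH[of j] Suc.IH[of i] i Suc.prems by simp
    also have "fact (n - i) = (real n - real i) * fact (n - j)"
      using i Suc by (subst fact_reduce) (auto simp: of_nat_diff)
    also have "real (Stirling m i) * (fact n / ((real n - real i) * fact (n - j))) / real n ^ m * ((real n - real i) / n)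
      = real (Stirling m i) * (fact n / fact (n - j)) / real n ^ m / n"
      using i by simp
    also have "real (Stirling m j) * (fact n / fact (n - j)) / real n ^ m * (real j / n)
        + real (Stirling m i) * (fact n / fact (n - j)) / real n ^ m / n
      = (real j * real (Stirling m j) + real (Stirling m i)) * (fact n / fact (n - j)) / real n ^ Suc m"
      by (simp add: algebra_simps add_divide_distrib)
    also have "real j * real (Stirling m j) + real (Stirling m i) = real (Stirling (Suc m) j)"
      using Suc by (simp add: algebra_simps)
    finally show ?thesis by simp
  qed
qed

text \<open>Let p be the probability that one more letter completes the M - 1 letters b shared by
  consecutive windows. The rate is the mean of p - p^2. This vanishes for p = 0 and p = 1, and is (n
  - 1)/n^2 when b lacks exactly one type, where p = 1/n.\<close>

lemma entry_rate_eq_coupon_mu: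
  assumes "n \<ge> 1" "M \<ge> 1"
  shows "entry_rate n M = coupon_mu n M"
proof -
  let ?f = "\<lambda>a b. of_bool (full_word n (a @ b)) :: real"
  have "full_prob n M = word_mean n (1 + (M - 1)) (\<lambda>w. of_bool (full_word n w))"
    using assms by (simp add: full_prob_def)
  also have "\<dots> = word_mean n 1 (\<lambda>a. word_mean n (M - 1) (?f a))"
    by (rule word_mean_append)
  also have "\<dots> = word_mean n (M - 1) (\<lambda>b. word_mean n 1 (\<lambda>a. ?f a b))"
    by (rule word_mean_swap)
  finally have "entry_rate n M = word_mean n (M - 1) (\<lambda>b. word_mean n 1 (\<lambda>a. ?f a b)
      - (word_mean n 1 (\<lambda>a. ?f a b))\<^sup>2)"
    by (simp only: entry_rate_def pair_prob_def word_mean_diff)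
  also have "\<dots> = word_mean n (M - 1) (\<lambda>b. of_bool (card (set b) = n - 1) * ((real n - 1) / (real n)\<^sup>2))"
  proof (intro word_mean_cong)
    fix b assume b: "set b \<subseteq> {1..n}"
    let ?k = "card ({1..n} - set b)"
    have k: "card (set b) = n - 1 \<longleftrightarrow> ?k = 1"
      using assms(1) b card_mono[OF _ b] by (simp add: card_Diff_subset) linarith
    have "word_mean n 1 (\<lambda>a. ?f a b) = real ?k / n * 0 ^ (?k - 1) + (1 - real ?k / n) * 0 ^ ?k"
      unfolding word_mean_full_word[OF assms(1)] by (simp add: cover_prob_def)
    also have "\<dots> = (if ?k = 0 then 1 else if ?k = 1 then 1 / n else 0)"
      by (cases ?k) (auto simp del: card_0_eq)
    finally have *: "word_mean n 1 (\<lambda>a. ?f a b) = (if ?k = 0 then 1 else if ?k = 1 then 1 / n else 0)" .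
    show "word_mean n 1 (\<lambda>a. ?f a b) - (word_mean n 1 (\<lambda>a. ?f a b))\<^sup>2
      = of_bool (card (set b) = n - 1) * ((real n - 1) / (real n)\<^sup>2)"
      unfolding * k using assms(1) by (simp add: field_simps power2_eq_square del: card_0_eq)
  qed
  also have "\<dots> = real (Stirling (M - 1) (n - 1)) * fact n / real n ^ (M - 1) * ((real n - 1) / (real n)\<^sup>2)"
    unfolding word_mean_multc using assms(1) by (subst word_mean_card_set) auto
  also have "fact n = real n * fact (n - 1)"
    using assms(1) by (subst fact_reduce) auto
  also have "real (Stirling (M - 1) (n - 1)) * (real n * fact (n - 1)) / real n ^ (M - 1) * ((real n - 1) / (real n)\<^sup>2)
     = coupon_mu n M"
  proof -
    have "real n ^ M = real n ^ (M - 1) * real n" using assms(2) by (metis power_minus_mult less_eq_Suc_le One_nat_def)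
    then show ?thesis using assms(1) by (simp add: coupon_mu_def field_simps power2_eq_square)
  qed
  finally show ?thesis .
qed

text \<open>The product bound for all n letters. Far from sharp, but it suffices to make the entry
  rate smaller than M^(-4).\<close>

lemma full_prob_le:
  assumes "n \<ge> 1"
  shows "full_prob n M \<le> exp (- coupon_lambda n M)"
proof -
  define q where "q = (1 - 1 / real n) ^ M"
  have q: "0 \<le> q" "q \<le> 1" unfolding q_def using assms by (auto intro!: power_le_one)
  have "full_prob n M \<le> (1 - q) ^ n"
    unfolding full_prob_eq[OF assms] cover_prob_def q_def by (intro miss_iter_le_power assms) simp
  also have "\<dots> \<le> exp (- q) ^ n"
    using q exp_ge_add_one_self[of "- q"] by (intro power_mono) auto
  also have "\<dots> = exp (- coupon_lambda n M)"
    by (simp add: coupon_lambda_def q_def flip: exp_of_nat_mult)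
  finally show ?thesis .
qed

lemma full_prob_pos:
  assumes "n \<ge> 1" "n \<le> M"
  shows "full_prob n M > 0"
  unfolding full_prob_eq[OF assms(1)] using assms by (intro cover_prob_pos) auto

text \<open>The power is at least exp (- n/(n - 1)) \<ge> exp (- 2), and exp 1 \<le> 3 gives
  1/9.\<close>

lemma one_minus_inverse_power_ge:
  assumes "n \<ge> 2" "h \<le> n"
  shows "1 / 9 \<le> (1 - 1 / real n) ^ h"
proof -
  have n: "real n \<ge> 2" using assms by simp
  have "exp 2 = (exp 1 :: real)\<^sup>2" by (simp add: power2_eq_square flip: exp_add)
  also have "\<dots> \<le> 3\<^sup>2" using exp_le by (intro power_mono) auto
  finally have "1 / 9 \<le> exp (- 2 :: real)" by (simp add: exp_minus field_simps)
  also have "exp (- 2 :: real) \<le> exp (real n * (- 1 / (real n - 1)))"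
    using n by (simp add: field_simps)
  also have "\<dots> = (exp (- 1 / (real n - 1))) ^ n" by (rule exp_of_nat_mult)
  also have "\<dots> \<le> (1 - 1 / real n) ^ n"
  proof (intro power_mono)
    have "1 + 1 / (real n - 1) \<le> exp (1 / (real n - 1))" by (rule exp_ge_add_one_self)
    then have "exp (- (1 / (real n - 1))) \<le> inverse (1 + 1 / (real n - 1))"
      unfolding exp_minus using n by (intro le_imp_inverse_le) (auto intro: add_pos_nonneg)
    also have "\<dots> = 1 - 1 / real n" using n by (simp add: field_simps)
    finally show "exp (- 1 / (real n - 1)) \<le> 1 - 1 / real n" by simp
  qed simp
  also have "\<dots> \<le> (1 - 1 / real n) ^ h"
    using assms n by (intro power_decreasing) auto
  finally show ?thesis .
qed

text \<open>The bound on the pair and the lower bound on \<open>full_prob\<close> use the same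
  \<rho>, so the exponential terms cancel up to exp 2 * M^2 * (2 M + 4). What remains is (1 - z)^n,
  with z > 0 because the conditional probability is squared.\<close>

lemma pair_prob_le:
  assumes n: "n \<ge> 2" and M: "n \<le> M" and h: "1 \<le> h" "h \<le> n" "h < M"
  shows "pair_prob n M h \<le> exp 2 * (real M)\<^sup>2 * (2 * real M + 4)
     * exp (- (real h * coupon_lambda n M / (27 * real M))) * full_prob n M"
proof -
  have n1: "n \<ge> 1" using n by simp
  obtain \<rho> where \<rho>: "\<rho> > 0" "\<rho> \<le> (real M + 1) / real n"
    and low: "fact M / (real n * \<rho>) ^ M * (exp (real n * \<rho>) * (1 - exp (- \<rho>)) ^ n)
       \<le> (2 * real M + 4) * cover_prob n M n"
    using cover_prob_lower[OF n1 M] by blast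
  define m where "m = M - h"
  have m: "m \<ge> 1" "real M = real h + real m" "m \<le> M" "M = h + m" using h by (auto simp: m_def)
  \<comment> \<open>\<rho> is shared out in proportion to the lengths of the private part h and the
    common part m; the Stirling factors then recombine into those of M.\<close>
  define x where "x = \<rho> * h / M"
  define y where "y = \<rho> * m / M"
  have M0: "real M > 0" using h by simp
  have "x + y = \<rho> * (real h + real m) / M"
    by (simp add: x_def y_def distrib_left add_divide_distrib)
  then have xy: "x > 0" "y > 0" "x + y = \<rho>"
    using \<rho> h m(1) M0 unfolding m(2)[symmetric] by (auto simp: x_def y_def)
  define q where "q = (1 - 1 / real n) ^ h"
  have q: "1 / 9 \<le> q" "q \<le> 1"
    using one_minus_inverse_power_ge[OF n h(2)] n by (auto simp: q_def intro!: power_le_one)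
  \<comment> \<open>With 1 - exp (- x) alone, 1 - (1 - b) * exp (- y) would be exactly 1 - exp (-
    \<rho>), as for a single window. The factor 1 - q comes from the second copy of the covering
    probability.\<close>
  define b where "b = (1 - q) * (1 - exp (- x))"
  have b: "b \<ge> 0" using q xy by (simp add: b_def)
  define A where "A = fact h / (real n * x) ^ h * exp (real n * x)"
  define z where "z = q * (exp x - 1) / (exp \<rho> - 1)"
  \<comment> \<open>One factor of the square takes the product bound, which has no prefactor, the
    other the Chernoff bound.\<close>
  have c2: "(cover_prob n h k)\<^sup>2 \<le> A * b ^ k" if "k \<le> n" for k
  proof -
    have "cover_prob n h k \<le> (1 - q) ^ k"
      unfolding cover_prob_def q_def by (intro miss_iter_le_power n1 that)
    moreover have "cover_prob n h k \<le> A * (1 - exp (- x)) ^ k"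
      using miss_iter_chernoff[OF n1 that xy(1), of 0 h] by (simp add: cover_prob_def A_def)
    ultimately have "cover_prob n h k * cover_prob n h k \<le> (1 - q) ^ k * (A * (1 - exp (- x)) ^ k)"
      using q that by (intro mult_mono cover_prob_nonneg) auto
    then show ?thesis by (simp add: power2_eq_square b_def power_mult_distrib mult_ac)
  qed
  have er: "exp \<rho> > 1" using \<rho> by simp
  have "pair_prob n M h \<le> miss_iter n m (\<lambda>k. A * b ^ k) n"
    unfolding pair_prob_eq[OF n1] m_def by (intro miss_iter_mono c2) auto
  also have "\<dots> = A * miss_iter n m (\<lambda>k. b ^ k) n" by (rule miss_iter_cmult)
  also have "\<dots> \<le> A * (fact m / (real n * y) ^ m * (exp (real n * y) * (1 - (1 - b) * exp (- y)) ^ n))"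
    using xy b by (intro mult_left_mono miss_iter_chernoff n1) (auto simp: A_def)
  also have "1 - (1 - b) * exp (- y) = (1 - exp (- \<rho>)) * (1 - z)"
  proof -
    have e: "exp (- y) = exp x * exp (- \<rho>)" using xy(3) by (simp flip: exp_add)
    have e': "exp (- x) * exp x = 1" "exp (- \<rho>) * exp \<rho> = 1" by (simp_all flip: exp_add)
    have "(1 - exp (- \<rho>)) * z = exp (- \<rho>) * ((exp \<rho> - 1) * z)"
      using e' by (simp add: algebra_simps)
    also have "(exp \<rho> - 1) * z = q * (exp x - 1)" using er by (simp add: z_def)
    finally have z: "(1 - exp (- \<rho>)) * z = exp (- \<rho>) * (q * (exp x - 1))" .
    have "1 - (1 - b) * exp (- y) = 1 - exp (- \<rho>) * (exp x - (1 - q) * (exp x - exp (- x) * exp x))"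
      unfolding e b_def by (simp add: algebra_simps)
    also have "\<dots> = (1 - exp (- \<rho>)) * (1 - z)"
      unfolding e' right_diff_distrib[of _ 1 z] z by (simp add: algebra_simps)
    finally show ?thesis .
  qed
  also have "A * (fact m / (real n * y) ^ m * (exp (real n * y) * ((1 - exp (- \<rho>)) * (1 - z)) ^ n))
    = fact h / (real n * x) ^ h * (fact m / (real n * y) ^ m) * exp (real n * \<rho>)
        * ((1 - exp (- \<rho>)) ^ n * (1 - z) ^ n)"
    unfolding xy(3)[symmetric] by (simp add: A_def power_mult_distrib distrib_left exp_add)
  also have "\<dots> \<le> fact h / (real n * x) ^ h * (fact m / (real n * y) ^ m) * exp (real n * \<rho>)
        * ((1 - exp (- \<rho>)) ^ n * exp (- (n * z)))"
  proof (intro mult_left_mono)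
    have "q * (exp x - 1) \<le> 1 * (exp \<rho> - 1)" using q xy by (intro mult_mono) auto
    then have "z \<le> 1" using er by (simp add: z_def divide_le_eq)
    then have "(1 - z) ^ n \<le> exp (- z) ^ n"
      using exp_ge_add_one_self[of "- z"] by (intro power_mono) auto
    then show "(1 - z) ^ n \<le> exp (- (n * z))" by (simp flip: exp_of_nat_mult)
  qed (use xy \<rho> in auto)
  also have "\<dots> \<le> exp 2 * (real M)\<^sup>2 * (fact M / (real n * \<rho>) ^ M) * exp (real n * \<rho>)
        * ((1 - exp (- \<rho>)) ^ n * exp (- (n * z)))"
  proof (intro mult_right_mono)
    \<comment> \<open>With this s the quotient k! / (n \<rho> k / M)^k is s^k up to a polynomial
      factor, for every k; the powers for h and m multiply to s^M.\<close>
    define s where "s = real M / (exp 1 * (real n * \<rho>))"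
    have s: "s > 0" using M0 n \<rho> by (simp add: s_def)
    have *: "fact k / (real n * (\<rho> * k / M)) ^ k \<le> exp 1 * real M * s ^ k" if k: "1 \<le> k" "k \<le> M" for k
    proof -
      have pos: "real n * (\<rho> * k / M) > 0" using k n \<rho> M0 by simp
      have "fact k \<le> exp 1 * real k * (real k / exp 1) ^ k" using k by (intro fact_le_power_exp)
      also have "real k / exp 1 = s * (real n * (\<rho> * k / M))"
        using M0 n \<rho> by (simp add: s_def)
      also have "exp 1 * real k * (s * (real n * (\<rho> * k / M))) ^ k
          \<le> exp 1 * real M * s ^ k * (real n * (\<rho> * k / M)) ^ k"
      proof -
        have "exp 1 * real k * (s ^ k * (real n * (\<rho> * k / M)) ^ k)
            \<le> exp 1 * real M * (s ^ k * (real n * (\<rho> * k / M)) ^ k)"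
          using s pos k by (intro mult_right_mono mult_nonneg_nonneg) (auto intro!: zero_le_power)
        then show ?thesis by (simp only: power_mult_distrib[of s] mult.assoc)
      qed
      finally show ?thesis using pos by (simp add: divide_le_eq)
    qed
    have "fact h / (real n * x) ^ h * (fact m / (real n * y) ^ m) \<le> (exp 1 * real M * s ^ h) * (exp 1 * real M * s ^ m)"
      unfolding x_def y_def using h m s \<rho> n M0 by (intro mult_mono *) auto
    also have "\<dots> = exp 2 * (real M)\<^sup>2 * ((real M / exp 1) ^ M / (real n * \<rho>) ^ M)"
    proof -
      have "s ^ h * s ^ m = s ^ M" by (subst m(4)) (simp add: power_add)
      also have "\<dots> = (real M / exp 1) ^ M / (real n * \<rho>) ^ M"
        unfolding s_def by (simp add: power_divide power_mult_distrib)
      moreover have "exp (2::real) = exp 1 * exp 1" by (simp flip: exp_add)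
      ultimately show ?thesis by (simp add: power2_eq_square mult_ac)
    qed
    also have "\<dots> \<le> exp 2 * (real M)\<^sup>2 * (fact M / (real n * \<rho>) ^ M)"
      using \<rho> by (intro mult_left_mono divide_right_mono power_exp_le_fact) auto
    finally show "fact h / (real n * x) ^ h * (fact m / (real n * y) ^ m)
      \<le> exp 2 * (real M)\<^sup>2 * (fact M / (real n * \<rho>) ^ M)" .
  qed (use \<rho> in auto)
  also have "\<dots> = exp 2 * (real M)\<^sup>2 * exp (- (n * z))
      * (fact M / (real n * \<rho>) ^ M * (exp (real n * \<rho>) * (1 - exp (- \<rho>)) ^ n))"
    by simp
  also have "\<dots> \<le> exp 2 * (real M)\<^sup>2 * exp (- (n * z)) * ((2 * real M + 4) * cover_prob n M n)"
    by (intro mult_left_mono low) auto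
  also have "\<dots> \<le> exp 2 * (real M)\<^sup>2 * exp (- (real h * coupon_lambda n M / (27 * real M))) * ((2 * real M + 4) * cover_prob n M n)"
  proof (intro mult_right_mono mult_left_mono)
    \<comment> \<open>The 3 bounds exp 1, the price of \<rho> \<le> M/n + 1. Together with q \<ge>
      1/9 it makes the 27 of the exponent.\<close>
    have "coupon_lambda n M / (3 * real n) = (1 - 1 / real n) ^ M / 3"
      using n by (simp add: coupon_lambda_def)
    also have "\<dots> \<le> exp (- 1 / real n) ^ M / 3"
      using exp_ge_add_one_self[of "- 1 / real n"] n by (intro divide_right_mono power_mono) auto
    also have "\<dots> = exp (- (real M / n)) / 3" by (simp flip: exp_of_nat_mult)
    also have "\<dots> \<le> exp (- (real M / n)) / exp 1"
      using exp_le by (intro divide_left_mono) auto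
    also have "\<dots> = exp (- (real M / n) - 1)" by (simp add: exp_diff)
    also have "\<dots> \<le> exp (- \<rho>)"
    proof -
      have "1 / real n \<le> 1" using n by simp
      then show ?thesis using \<rho>(2) by (simp add: add_divide_distrib)
    qed
    also have "\<dots> \<le> \<rho> / (exp \<rho> - 1)"
    proof -
      have "1 - \<rho> \<le> exp (- \<rho>)" using exp_ge_add_one_self[of "- \<rho>"] by simp
      then have "exp (- \<rho>) * (exp \<rho> - 1) \<le> \<rho>" by (simp add: right_diff_distrib flip: exp_add)
      then show ?thesis using er by (simp add: pos_le_divide_eq)
    qed
    finally have 1: "coupon_lambda n M / (3 * real n) \<le> \<rho> / (exp \<rho> - 1)" .
    have "real h * coupon_lambda n M / (27 * real M) = n * ((1 / 9) * (real h / M * (coupon_lambda n M / (3 * real n))))"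
      using n by simp
    also have "\<dots> \<le> n * (q * (real h / M * (\<rho> / (exp \<rho> - 1))))"
      using q 1 n er \<rho> by (intro mult_left_mono mult_mono) (auto simp: coupon_lambda_def)
    also have "\<dots> = n * (q * x / (exp \<rho> - 1))" by (simp add: x_def)
    also have "\<dots> \<le> n * z"
    proof -
      have "x \<le> exp x - 1" using exp_ge_add_one_self[of x] by linarith
      then show ?thesis
        unfolding z_def using q er by (intro mult_left_mono divide_right_mono) auto
    qed
    finally show "exp (- (n * z)) \<le> exp (- (real h * coupon_lambda n M / (27 * real M)))" by simp
  qed (use cover_prob_nonneg[of n n M] in auto)
  finally show ?thesis by (simp add: full_prob_eq[OF n1] mult_ac)
qed

section \<open>Asymptotics of the survival probability\<close>

lemma exp_le_one_minus:
  fixes v :: real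
  assumes "v < 1"
  shows "exp (- (v / (1 - v))) \<le> 1 - v"
proof -
  have "1 / (1 - v) = 1 + v / (1 - v)" using assms by (simp add: field_simps)
  also have "\<dots> \<le> exp (v / (1 - v))" by (rule exp_ge_add_one_self)
  finally have "inverse (exp (v / (1 - v))) \<le> inverse (1 / (1 - v))"
    using assms by (intro le_imp_inverse_le) auto
  then show ?thesis by (simp add: exp_minus)
qed

lemma survival_mult_le:
  assumes "n \<ge> 1"
  shows "survival n M (k * L) \<le> survival n M L ^ k"
proof (induction k)
  case 0
  then show ?case using survival_le_1[OF assms] by simp
next
  case (Suc k)
  have "survival n M (L + k * L) \<le> survival n M L * survival n M (k * L)"
    by (intro survival_add_le assms)
  also have "\<dots> \<le> survival n M L * survival n M L ^ k"
    by (intro mult_left_mono Suc survival_nonneg)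
  finally show ?case by simp
qed

text \<open>Each gluing of blocks loses at most M * rate. An earlier loss is only shrunk when
  multiplied by a survival probability, so the losses add up.\<close>

lemma survival_mult_ge:
  assumes "n \<ge> 1" "M \<ge> 1" "M \<le> L"
  shows "survival n M L ^ Suc k - real k * (real M * entry_rate n M) \<le> survival n M (Suc k * L)"
proof (induction k)
  case (Suc k)
  let ?u = "survival n M L" and ?e = "real M * entry_rate n M"
  have "?u ^ Suc (Suc k) - real (Suc k) * ?e \<le> ?u * ?u ^ Suc k - ?u * (real k * ?e) - ?e"
  proof -
    have "?u * (real k * ?e) \<le> 1 * (real k * ?e)"
      using survival_le_1[OF assms(1)] entry_rate_nonneg[OF assms(1,2)] by (intro mult_right_mono) auto
    then show ?thesis by (simp add: algebra_simps)
  qed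
  also have "\<dots> = ?u * (?u ^ Suc k - real k * ?e) - ?e" by (simp add: algebra_simps)
  also have "\<dots> \<le> ?u * survival n M (Suc k * L) - ?e"
    by (intro diff_right_mono mult_left_mono Suc survival_nonneg)
  also have "\<dots> \<le> survival n M (L + Suc k * L)"
    using assms by (intro survival_add_ge) auto
  finally show ?case by (simp only: mult_Suc)
qed simp

lemma survival_le_exp:
  assumes "n \<ge> 1" "L \<ge> 1"
  shows "survival n M t \<le> exp (- ((1 - survival n M L) * (real t / real L - 1)))"
proof -
  let ?k = "t div L" and ?v = "1 - survival n M L"
  have v: "?v \<ge> 0" using survival_le_1[OF assms(1)] by simp
  have "survival n M t \<le> survival n M (?k * L)"
    by (intro survival_antimono assms) simp
  also have "\<dots> \<le> survival n M L ^ ?k" by (intro survival_mult_le assms)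
  also have "\<dots> \<le> exp (- ?v) ^ ?k"
    using exp_ge_add_one_self[of "- ?v"] survival_nonneg by (intro power_mono) auto
  also have "\<dots> = exp (- (?v * real ?k))"
    by (subst exp_of_nat_mult[symmetric]) (simp add: algebra_simps)
  also have "\<dots> \<le> exp (- (?v * (real t / real L - 1)))"
  proof -
    have "real t / real L - 1 \<le> real ?k"
    proof -
      have "t < L * (?k + 1)" using assms(2) dividend_less_times_div[of L t] by simp
      then have "real t < real L * (real ?k + 1)" by (metis of_nat_1 of_nat_add of_nat_less_iff of_nat_mult)
      then have "real t / real L < real ?k + 1" using assms(2) by (simp add: pos_divide_less_eq mult.commute)
      then show ?thesis by simp
    qed
    then have "?v * (real t / real L - 1) \<le> ?v * real ?k" using v by (rule mult_left_mono)
    then show ?thesis by simp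
  qed
  finally show ?thesis .
qed

text \<open>Here t is rounded up to a multiple of L, in \<open>survival_le_exp\<close> down;
  accordingly 1 - v \<ge> exp (- v / (1 - v)) replaces 1 - v \<le> exp (- v).\<close>

lemma survival_ge_exp:
  assumes "n \<ge> 1" "M \<ge> 1" "M \<le> L" "survival n M L > 0"
  shows "exp (- ((real t / real L + 1) * ((1 - survival n M L) / survival n M L)))
     - (real t / real L + 1) * (real M * entry_rate n M) \<le> survival n M t"
proof -
  let ?k = "t div L" and ?v = "1 - survival n M L"
  have v: "0 \<le> ?v" "?v < 1" using survival_le_1[OF assms(1)] assms by auto
  have k: "real ?k \<le> real t / real L" by (rule of_nat_div_le_of_nat)
  have "exp (- ((real t / real L + 1) * (?v / (1 - ?v)))) \<le> exp (- (real (Suc ?k) * (?v / (1 - ?v))))"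
  proof -
    have "real (Suc ?k) * (?v / (1 - ?v)) \<le> (real t / real L + 1) * (?v / (1 - ?v))"
      using k v by (intro mult_right_mono divide_nonneg_nonneg) auto
    then show ?thesis by simp
  qed
  also have "\<dots> = exp (- (?v / (1 - ?v))) ^ Suc ?k" by (subst exp_of_nat_mult[symmetric]) simp
  also have "\<dots> \<le> (1 - ?v) ^ Suc ?k"
    using exp_le_one_minus[OF v(2)] by (intro power_mono) auto
  also have "(1 - ?v) ^ Suc ?k \<le> survival n M (Suc ?k * L) + real ?k * (real M * entry_rate n M)"
    using survival_mult_ge[OF assms(1-3), of ?k] by simp
  also have "survival n M (Suc ?k * L) \<le> survival n M t"
  proof (intro survival_antimono assms)
    have "t mod L < L" using assms by simp
    then show "t \<le> Suc ?k * L" using div_mult_mod_eq[of t L] by (simp only: mult_Suc)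
  qed
  also have "real ?k * (real M * entry_rate n M) \<le> (real t / real L + 1) * (real M * entry_rate n M)"
    using k entry_rate_nonneg[OF assms(1,2)] by (intro mult_right_mono) auto
  finally show ?thesis by simp
qed

locale admissible_windows =
  fixes M :: "nat \<Rightarrow> nat"
  assumes M_ge: "eventually (\<lambda>n. n \<le> M n) sequentially"
    and M_le: "eventually (\<lambda>n. real (M n) \<le> real n * ln (real n)) sequentially"
    and lambda: "filterlim (\<lambda>n. coupon_lambda n (M n) / (ln (real (M n)))\<^sup>2) at_top sequentially"
begin

abbreviation rate :: "nat \<Rightarrow> real" where "rate n \<equiv> entry_rate n (M n)"

text \<open>Long enough that terms of order M * rate, from the initial window and from the cuts
  between blocks, are negligible against block * rate; short enough that block * rate \<rightarrow>
  0.\<close>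

abbreviation block :: "nat \<Rightarrow> nat" where "block n \<equiv> (M n)\<^sup>2"

text \<open>The lag is small enough for \<open>gap n / n \<rightarrow> 0\<close>, yet the exponent \<open>gap n * \<lambda> / M\<close> of the pair
  bound is at least \<open>sqrt \<lambda>\<close> because \<open>M \<le> n ln n\<close>, and this dominates \<open>ln M\<close>.\<close>

definition gap :: "nat \<Rightarrow> nat" where
  "gap n = nat \<lceil>ln (real (M n)) / sqrt (coupon_lambda n (M n)) * real n\<rceil>"

lemma M_at_top: "filterlim (\<lambda>n. real (M n)) at_top sequentially"
  by (rule filterlim_at_top_mono[OF filterlim_real_sequentially]) (use M_ge in \<open>eventually_elim, simp\<close>)

lemma eventually_M_ge: "eventually (\<lambda>n. c \<le> real (M n)) sequentially"
  using M_at_top by (simp add: filterlim_at_top)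

lemma eventually_n_ge: "eventually (\<lambda>n. c \<le> real n) sequentially"
  using filterlim_real_sequentially by (simp add: filterlim_at_top)

lemma eventually_lambda_ge:
  "eventually (\<lambda>n. c * (ln (real (M n)))\<^sup>2 \<le> coupon_lambda n (M n)) sequentially"
proof -
  have "eventually (\<lambda>n. c \<le> coupon_lambda n (M n) / (ln (real (M n)))\<^sup>2) sequentially"
    using lambda by (simp add: filterlim_at_top)
  then show ?thesis using eventually_M_ge[of 2]
  proof eventually_elim
    case (elim n)
    then have "ln (real (M n)) > 0" by simp
    then show ?case using elim by (simp add: pos_le_divide_eq)
  qed
qed

lemma gap_ratio: "(\<lambda>n. real (gap n) / real n) \<longlonglongrightarrow> 0"
proof -
  let ?e = "\<lambda>n. ln (real (M n)) / sqrt (coupon_lambda n (M n))"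
  have "(\<lambda>n. inverse (sqrt (coupon_lambda n (M n) / (ln (real (M n)))\<^sup>2))) \<longlonglongrightarrow> 0"
    by (intro tendsto_inverse_0_at_top filterlim_compose[OF sqrt_at_top lambda])
  moreover have "eventually (\<lambda>n. inverse (sqrt (coupon_lambda n (M n) / (ln (real (M n)))\<^sup>2)) = ?e n) sequentially"
    using eventually_M_ge[of 2]
  proof eventually_elim
    case (elim n)
    then have "ln (real (M n)) > 0" by simp
    then show ?case by (simp add: real_sqrt_divide)
  qed
  ultimately have e0: "?e \<longlonglongrightarrow> 0" by (rule Lim_transform_eventually)
  have n0: "(\<lambda>n. 1 / real n) \<longlonglongrightarrow> 0" by (rule lim_1_over_n)
  show ?thesis
  proof (rule tendsto_sandwich[OF _ _ tendsto_const[of 0]])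
    show "eventually (\<lambda>n. real (gap n) / real n \<le> ?e n + 1 / real n) sequentially"
      using eventually_M_ge[of 1] eventually_lambda_ge[of 0] eventually_n_ge[of 1]
    proof eventually_elim
      case (elim n)
      then have "?e n * real n \<ge> 0" by simp
      then have "real (gap n) \<le> ?e n * real n + 1"
        unfolding gap_def using ceiling_correct[of "?e n * real n"] by linarith
      then show ?case using elim by (simp add: field_simps)
    qed
    show "(\<lambda>n. ?e n + 1 / real n) \<longlonglongrightarrow> 0"
      using tendsto_add[OF e0 n0] by simp
  qed auto
qed

lemma eventually_gap:
  "eventually (\<lambda>n. 1 \<le> gap n \<and> gap n \<le> n \<and> gap n < M n) sequentially"
proof -
  have "eventually (\<lambda>n. real (gap n) / real n < 1) sequentially"
    using gap_ratio by (rule order_tendstoD) simp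
  then show ?thesis
    using M_ge eventually_M_ge[of 2] eventually_lambda_ge[of 1] eventually_n_ge[of 2]
  proof eventually_elim
    case (elim n)
    have l: "ln (real (M n)) > 0" using elim by simp
    have "coupon_lambda n (M n) > 0" using elim(4) zero_less_power[OF l, of 2] by linarith
    then have "0 < ln (real (M n)) / sqrt (coupon_lambda n (M n)) * real n" using l elim by simp
    then have "1 \<le> gap n" unfolding gap_def by linarith
    moreover have "gap n < n" using elim by simp
    ultimately show ?case using elim by simp
  qed
qed

text \<open>The constant is 270 = 27 * 10: the exponent becomes 10 * ln M. Five of the ten powers of
  M pay for the polynomial prefactor of \<open>pair_prob_le\<close>, five remain.\<close>

lemma eventually_pair_prob_le:
  "eventually (\<lambda>n. pair_prob n (M n) (gap n) \<le> full_prob n (M n) / real (M n) ^ 5) sequentially"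
  using eventually_gap eventually_M_ge[of 6] M_ge M_le eventually_n_ge[of 2] eventually_lambda_ge[of "270\<^sup>2"]
proof eventually_elim
  case (elim n)
  define m where "m = real (M n)"
  define lam where "lam = coupon_lambda n (M n)"
  have m: "m \<ge> 6" and nm: "real n \<le> m" and mn: "m \<le> real n * ln (real n)" and n2: "real n \<ge> 2"
    using elim by (auto simp: m_def)
  have l: "ln m > 0" using m by simp
  have lam: "270\<^sup>2 * (ln m)\<^sup>2 \<le> lam" using elim by (simp add: lam_def m_def)
  have sl: "270 * ln m \<le> sqrt lam"
    using lam by (intro real_le_rsqrt) (simp add: power_mult_distrib)
  have lpos: "lam > 0" using lam l by (smt (verit) zero_less_power mult_pos_pos)
  have "10 * ln m \<le> sqrt lam / 27" using sl by simp
  also have "\<dots> = ln m / sqrt lam * real n * lam / (27 * (real n * ln m))"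
    using l lpos n2 by (simp add: field_simps)
  also have "\<dots> \<le> real (gap n) * lam / (27 * (real n * ln m))"
  proof (intro divide_right_mono mult_right_mono)
    show "ln m / sqrt lam * real n \<le> real (gap n)"
      unfolding gap_def m_def lam_def by linarith
  qed (use l lpos n2 in auto)
  \<comment> \<open>From M \<le> n ln n \<le> n ln M.\<close>
  also have "\<dots> \<le> real (gap n) * lam / (27 * m)"
  proof (intro divide_left_mono)
    have "real n * ln (real n) \<le> real n * ln m" using nm n2 by (intro mult_left_mono) auto
    then show "27 * m \<le> 27 * (real n * ln m)" using mn by simp
  qed (use l lpos n2 m in auto)
  finally have "exp (- (real (gap n) * lam / (27 * m))) \<le> exp (- (10 * ln m))" by simp
  also have "\<dots> = inverse (m ^ 10)"
    using m exp_of_nat_mult[of 10 "ln m"] by (simp add: exp_minus)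
  finally have e: "exp (- (real (gap n) * lam / (27 * m))) \<le> inverse (m ^ 10)" .
  have e2: "exp 2 * (2 * m + 4) \<le> m ^ 3"
  proof -
    have "exp 2 = (exp 1 :: real)\<^sup>2" by (simp add: power2_eq_square flip: exp_add)
    also have "\<dots> \<le> 3\<^sup>2" using exp_le by (intro power_mono) auto
    finally have "exp 2 * (2 * m + 4) \<le> 9 * (2 * m + 4)" using m by (intro mult_right_mono) auto
    also have "\<dots> \<le> 36 * m" using m by simp
    also have "\<dots> \<le> m * m * m" using m mult_mono[of 6 m 6 m] by (intro mult_right_mono) auto
    finally show ?thesis by (simp add: power3_eq_cube)
  qed
  have fp: "full_prob n (M n) \<ge> 0"
    unfolding full_prob_def by (intro word_mean_nonneg) simp
  have "pair_prob n (M n) (gap n) \<le> exp 2 * m\<^sup>2 * (2 * m + 4) * exp (- (real (gap n) * lam / (27 * m))) * full_prob n (M n)"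
    unfolding m_def lam_def using elim by (intro pair_prob_le) auto
  also have "\<dots> = (exp 2 * (2 * m + 4)) * (m\<^sup>2 * exp (- (real (gap n) * lam / (27 * m))) * full_prob n (M n))"
    by simp
  also have "\<dots> \<le> m ^ 3 * (m\<^sup>2 * inverse (m ^ 10) * full_prob n (M n))"
    using e e2 m fp by (intro mult_mono mult_left_mono mult_right_mono) auto
  also have "\<dots> = full_prob n (M n) / m ^ 5"
  proof -
    have "m ^ 10 = m ^ 5 * m ^ 5" by (simp flip: power_add)
    moreover have "m ^ 3 * m\<^sup>2 = m ^ 5" by (simp flip: power_add)
    ultimately show ?thesis using m by (simp add: field_simps)
  qed
  finally show ?case by (simp add: m_def)
qed

text \<open>In \<open>full_prob_le_pair_prob\<close> at lag \<open>gap n\<close> the pair term takes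
  up at most half of \<open>full_prob\<close>, so gap * rate is at least the other half. Since
  \<open>full_prob\<close> is positive, so is the rate.\<close>

lemma eventually_full_prob_le:
  "eventually (\<lambda>n. full_prob n (M n) \<le> 2 * real (M n) * rate n \<and> 0 < rate n) sequentially"
  using eventually_pair_prob_le eventually_gap eventually_M_ge[of 2] M_ge eventually_n_ge[of 1]
proof eventually_elim
  case (elim n)
  have n: "n \<ge> 1" "M n \<ge> 1" using elim by auto
  have pos: "full_prob n (M n) > 0" using elim n by (intro full_prob_pos) auto
  have "2 ^ 1 \<le> real (M n) ^ 1" using elim by simp
  also have "\<dots> \<le> real (M n) ^ 5" using elim by (intro power_increasing) auto
  finally have "full_prob n (M n) / real (M n) ^ 5 \<le> full_prob n (M n) / 2"
    using pos elim by (intro divide_left_mono) (auto intro!: mult_pos_pos zero_less_power)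
  then have "pair_prob n (M n) (gap n) \<le> full_prob n (M n) / 2" using elim by linarith
  moreover have "full_prob n (M n) \<le> pair_prob n (M n) (gap n) + real (gap n) * rate n"
    using n elim by (intro full_prob_le_pair_prob) auto
  moreover have "real (gap n) * rate n \<le> real (M n) * rate n"
    using elim entry_rate_nonneg[OF n] by (intro mult_right_mono) auto
  ultimately have le: "full_prob n (M n) \<le> 2 * real (M n) * rate n" by linarith
  moreover have "rate n \<noteq> 0" using le pos by auto
  ultimately show ?case using entry_rate_nonneg[OF n] by simp
qed

text \<open>From exp (- \<lambda>) with \<lambda> \<ge> 4 (ln M)^2 \<ge> 4 ln M; the fourth power
  beats the block length M^2.\<close>

lemma eventually_rate_le:
  "eventually (\<lambda>n. rate n \<le> 1 / real (M n) ^ 4) sequentially"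
  using eventually_lambda_ge[of 4] eventually_M_ge[of 3] eventually_n_ge[of 1]
proof eventually_elim
  case (elim n)
  let ?l = "ln (real (M n))"
  have "1 \<le> ln (3::real)" using exp_le by (subst ln_ge_iff) auto
  also have "\<dots> \<le> ?l" using elim by simp
  finally have l: "1 \<le> ?l" .
  have "4 * ?l \<le> 4 * ?l\<^sup>2" using l by (simp add: power2_eq_square)
  also have "\<dots> \<le> coupon_lambda n (M n)" using elim by simp
  finally have lam: "4 * ?l \<le> coupon_lambda n (M n)" .
  have "rate n \<le> full_prob n (M n)"
    unfolding entry_rate_def using pair_prob_nonneg[of n "M n" 1] by linarith
  also have "\<dots> \<le> exp (- coupon_lambda n (M n))" using elim by (intro full_prob_le) simp
  also have "\<dots> \<le> exp (- (4 * ?l))" using lam by simp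
  also have "\<dots> = 1 / real (M n) ^ 4"
    using elim exp_of_nat_mult[of 4 ?l] by (simp add: exp_minus inverse_eq_divide)
  finally show ?case .
qed

lemma rate_block: "(\<lambda>n. rate n * real (block n)) \<longlonglongrightarrow> 0"
proof (rule tendsto_sandwich[OF _ _ tendsto_const[of 0]])
  have "(\<lambda>n. inverse (real (M n))) \<longlonglongrightarrow> 0"
    by (rule tendsto_inverse_0_at_top[OF M_at_top])
  then show "(\<lambda>n. (inverse (real (M n)))\<^sup>2) \<longlonglongrightarrow> 0"
    using tendsto_power[of _ 0 _ 2] by fastforce
  show "eventually (\<lambda>n. rate n * real (block n) \<le> (inverse (real (M n)))\<^sup>2) sequentially"
    using eventually_rate_le eventually_M_ge[of 1]
  proof eventually_elim
    case (elim n)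
    have "rate n * real (block n) \<le> 1 / real (M n) ^ 4 * real (block n)"
      using elim by (intro mult_right_mono) auto
    also have "\<dots> = (inverse (real (M n)))\<^sup>2"
      using elim by (simp add: field_simps power2_eq_square power4_eq_xxxx)
    finally show ?case .
  qed
  show "eventually (\<lambda>n. 0 \<le> rate n * real (block n)) sequentially"
    using eventually_full_prob_le by eventually_elim simp
qed

text \<open>\<open>failure_le\<close> and \<open>failure_ge\<close> divided by rate * block. The
  initial window gives 2/M, the M lost starting points the factor 1 - 1/M, and the near, middle and
  far pairs gap/n, 4/M and rate * block.\<close>

lemma block_failure_asymp:
  "(\<lambda>n. (1 - survival n (M n) (block n)) / (rate n * real (block n))) \<longlonglongrightarrow> 1"
proof -
  let ?i = "\<lambda>n. inverse (real (M n))"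
  let ?lo = "\<lambda>n. (1 - ?i n) * (1 - (real (gap n) / real n + 4 * ?i n + rate n * real (block n)))"
  let ?hi = "\<lambda>n. 1 + 2 * ?i n"
  have i0: "?i \<longlonglongrightarrow> 0"
    by (rule tendsto_inverse_0_at_top[OF M_at_top])
  have "?lo \<longlonglongrightarrow> (1 - 0) * (1 - (0 + 4 * 0 + 0))"
    by (intro tendsto_intros i0 gap_ratio rate_block)
  then have lo: "?lo \<longlonglongrightarrow> 1" by simp
  have "?hi \<longlonglongrightarrow> 1 + 2 * 0" by (intro tendsto_intros i0)
  then have hi: "?hi \<longlonglongrightarrow> 1" by simp
  show ?thesis
  proof (rule tendsto_sandwich[OF _ _ lo hi])
    show "eventually (\<lambda>n. (1 - survival n (M n) (block n)) / (rate n * real (block n)) \<le> ?hi n) sequentially"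
      using eventually_full_prob_le eventually_M_ge[of 1] eventually_n_ge[of 1]
    proof eventually_elim
      case (elim n)
      have "1 - survival n (M n) (block n) \<le> full_prob n (M n) + real (block n) * rate n"
        using elim by (intro failure_le) (auto simp: power2_eq_square)
      also have "\<dots> \<le> 2 * real (M n) * rate n + real (block n) * rate n" using elim by simp
      also have "\<dots> = ?hi n * (rate n * real (block n))"
        using elim by (simp add: field_simps power2_eq_square)
      finally show ?case using elim by (simp add: pos_divide_le_eq)
    qed
    show "eventually (\<lambda>n. ?lo n \<le> (1 - survival n (M n) (block n)) / (rate n * real (block n))) sequentially"
      using eventually_full_prob_le eventually_pair_prob_le eventually_gap eventually_M_ge[of 1] eventually_n_ge[of 1]
    proof eventually_elim
      case (elim n)
      define m where "m = real (M n)"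
      have m: "m \<ge> 1" using elim by (simp add: m_def)
      have r: "rate n > 0" using elim by simp
      have "(m + 1) * pair_prob n (M n) (gap n) \<le> (2 * m) * (2 * m * rate n / m ^ 5)"
      proof (intro mult_mono)
        have "full_prob n (M n) / m ^ 5 \<le> 2 * m * rate n / m ^ 5"
          using elim m by (intro divide_right_mono) (auto simp: m_def)
        then show "pair_prob n (M n) (gap n) \<le> 2 * m * rate n / m ^ 5"
          using elim by (simp add: m_def)
      qed (use m pair_prob_nonneg in auto)
      also have "\<dots> = 4 * rate n * inverse (m ^ 3)"
        using m by (simp add: field_simps eval_nat_numeral)
      also have "\<dots> \<le> 4 * rate n * inverse (m ^ 1)"
        using m r by (intro mult_left_mono le_imp_inverse_le power_increasing) auto
      finally have p: "real (M n + 1) * pair_prob n (M n) (gap n) \<le> rate n * (4 * ?i n)"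
        by (simp add: m_def algebra_simps)
      have K: "real (block n - M n) = (1 - ?i n) * real (block n)"
        using m by (subst of_nat_diff) (auto simp: m_def power2_eq_square field_simps)
      have "?lo n * (rate n * real (block n)) = real (block n - M n)
          * (rate n - (real (gap n) * (rate n / real n) + rate n * (4 * ?i n) + real (block n) * (rate n)\<^sup>2))"
        unfolding K by (simp add: field_simps power2_eq_square)
      also have "\<dots> \<le> real (block n - M n) * (rate n - (real (gap n) * (rate n / real n)
          + real (M n + 1) * pair_prob n (M n) (gap n) + real (block n) * (rate n)\<^sup>2))"
        using p by (intro mult_left_mono) auto
      also have "\<dots> \<le> 1 - survival n (M n) (block n)"
        using elim by (intro failure_ge) (auto simp: power2_eq_square)
      finally show ?case using elim by (simp add: pos_le_divide_eq)
    qed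
  qed
qed

lemma block_failure_0: "(\<lambda>n. 1 - survival n (M n) (block n)) \<longlonglongrightarrow> 0"
proof -
  have "(\<lambda>n. (1 - survival n (M n) (block n)) / (rate n * real (block n)) * (rate n * real (block n))) \<longlonglongrightarrow> 1 * 0"
    by (intro tendsto_mult block_failure_asymp rate_block)
  moreover have "eventually (\<lambda>n. (1 - survival n (M n) (block n)) / (rate n * real (block n)) * (rate n * real (block n))
     = 1 - survival n (M n) (block n)) sequentially"
    using eventually_full_prob_le eventually_M_ge[of 1] by eventually_elim simp
  ultimately show ?thesis using Lim_transform_eventually by fastforce
qed

lemma survival_tendsto:
  assumes t: "(\<lambda>n. rate n * real (t n)) \<longlonglongrightarrow> x"
  shows "(\<lambda>n. survival n (M n) (t n)) \<longlonglongrightarrow> exp (- x)"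
proof -
  define v where "v n = 1 - survival n (M n) (block n)" for n
  define k where "k n = real (t n) / real (block n)" for n
  have v0: "v \<longlonglongrightarrow> 0" using block_failure_0 by (simp add: v_def[abs_def])
  have kr: "eventually (\<lambda>n. v n / (rate n * real (block n)) * (rate n * real (t n)) = k n * v n) sequentially"
    using eventually_full_prob_le eventually_M_ge[of 1] by eventually_elim (simp add: k_def field_simps)
  have "(\<lambda>n. v n / (rate n * real (block n)) * (rate n * real (t n))) \<longlonglongrightarrow> 1 * x"
    using block_failure_asymp unfolding v_def by (intro tendsto_mult t)
  then have kv: "(\<lambda>n. k n * v n) \<longlonglongrightarrow> x"
    using Lim_transform_eventually[OF _ kr] by simp
  have i0: "(\<lambda>n. inverse (real (M n))) \<longlonglongrightarrow> 0"
    by (rule tendsto_inverse_0_at_top[OF M_at_top])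
  \<comment> \<open>The total loss at the cuts between blocks is (rate * t + rate * block) / M, with
    bounded numerator.\<close>
  have "(\<lambda>n. rate n * real (t n) * inverse (real (M n)) + inverse (real (M n)) * (rate n * real (block n))) \<longlonglongrightarrow> x * 0 + 0 * 0"
    by (intro tendsto_intros t i0 rate_block)
  moreover have "eventually (\<lambda>n. rate n * real (t n) * inverse (real (M n)) + inverse (real (M n)) * (rate n * real (block n))
      = (k n + 1) * (real (M n) * rate n)) sequentially"
    using eventually_M_ge[of 1] by eventually_elim (simp add: k_def field_simps power2_eq_square)
  ultimately have err: "(\<lambda>n. (k n + 1) * (real (M n) * rate n)) \<longlonglongrightarrow> 0"
    using Lim_transform_eventually by fastforce
  have ev: "eventually (\<lambda>n. v n < 1) sequentially"
    using v0 by (rule order_tendstoD) simp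
  show ?thesis
  proof (rule tendsto_sandwich)
    have "(\<lambda>n. exp (- ((k n * v n + v n) / (1 - v n))) - (k n + 1) * (real (M n) * rate n))
      \<longlonglongrightarrow> exp (- ((x + 0) / (1 - 0))) - 0"
      by (intro tendsto_intros kv v0 err) simp
    then show "(\<lambda>n. exp (- ((k n * v n + v n) / (1 - v n))) - (k n + 1) * (real (M n) * rate n)) \<longlonglongrightarrow> exp (- x)"
      by simp
    have "(\<lambda>n. exp (- (k n * v n - v n))) \<longlonglongrightarrow> exp (- (x - 0))"
      by (intro tendsto_intros kv v0)
    then show "(\<lambda>n. exp (- (k n * v n - v n))) \<longlonglongrightarrow> exp (- x)" by simp
    show "eventually (\<lambda>n. survival n (M n) (t n) \<le> exp (- (k n * v n - v n))) sequentially"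
      using eventually_M_ge[of 1] eventually_n_ge[of 1]
    proof eventually_elim
      case (elim n)
      then have "survival n (M n) (t n) \<le> exp (- (v n * (k n - 1)))"
        unfolding v_def k_def by (intro survival_le_exp) auto
      then show ?case by (simp add: algebra_simps)
    qed
    show "eventually (\<lambda>n. exp (- ((k n * v n + v n) / (1 - v n))) - (k n + 1) * (real (M n) * rate n)
        \<le> survival n (M n) (t n)) sequentially"
      using eventually_M_ge[of 1] eventually_n_ge[of 1] ev
    proof eventually_elim
      case (elim n)
      then have "exp (- ((k n + 1) * (v n / survival n (M n) (block n))))
          - (k n + 1) * (real (M n) * rate n) \<le> survival n (M n) (t n)"
        unfolding v_def k_def by (intro survival_ge_exp) (auto simp: power2_eq_square)
      moreover have "survival n (M n) (block n) = 1 - v n" by (simp add: v_def)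
      moreover have "(k n + 1) * (v n / (1 - v n)) = (k n * v n + v n) / (1 - v n)"
        by (simp add: algebra_simps add_divide_distrib)
      ultimately show ?case by (simp only:)
    qed
  qed
qed

text \<open>Uniform in t, unlike \<open>survival_tendsto\<close>: this dominates the moments and
  makes T almost surely finite. Half of the asymptotic block failure probability is enough, whence
  the exponent rate * t / 2.\<close>

lemma eventually_survival_le:
  "eventually (\<lambda>n. \<forall>t. survival n (M n) t \<le> 2 * exp (- (rate n * real t / 2))) sequentially"
proof -
  define v where "v n = 1 - survival n (M n) (block n)" for n
  have "eventually (\<lambda>n. v n < 1 / 2) sequentially"
    using block_failure_0 unfolding v_def by (rule order_tendstoD) simp
  moreover have "eventually (\<lambda>n. 1 / 2 < v n / (rate n * real (block n))) sequentially"
    using block_failure_asymp unfolding v_def by (rule order_tendstoD) simp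
  ultimately show ?thesis
    using eventually_full_prob_le eventually_M_ge[of 1] eventually_n_ge[of 1]
  proof eventually_elim
    case (elim n)
    show ?case
    proof
      fix t
      have b: "real (block n) > 0" using elim by simp
      have "survival n (M n) t \<le> exp (- (v n * (real t / real (block n) - 1)))"
        unfolding v_def using elim by (intro survival_le_exp) auto
      also have "- (v n * (real t / real (block n) - 1)) \<le> 1 / 2 - rate n * real t / 2"
      proof -
        have "1 / 2 * (rate n * real (block n)) \<le> v n" using elim b by (simp add: pos_less_divide_eq)
        then have "1 / 2 * (rate n * real (block n)) * (real t / real (block n)) \<le> v n * (real t / real (block n))"
          by (intro mult_right_mono) auto
        then show ?thesis using elim b by (simp add: algebra_simps)
      qed
      also have "exp (1 / 2 - rate n * real t / 2) = exp (1 / 2) * exp (- (rate n * real t / 2))"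
        by (simp flip: exp_add)
      also have "\<dots> \<le> 2 * exp (- (rate n * real t / 2))"
      proof (intro mult_right_mono)
        have "exp (1 / 2 :: real) = sqrt (exp 1)"
          by (rule real_sqrt_unique[symmetric]) (auto simp: power2_eq_square simp flip: exp_add)
        also have "\<dots> \<le> sqrt (2\<^sup>2)" using exp_le by (intro real_sqrt_le_mono) auto
        finally show "exp (1 / 2 :: real) \<le> 2" by simp
      qed simp
      finally show "survival n (M n) t \<le> 2 * exp (- (rate n * real t / 2))" by simp
    qed
  qed
qed

end

section \<open>From tails to exponential limits\<close>

text \<open>Layer-cake formula: Y^(k + 1) is the integral of (k + 1) x^k over 0 \<le> x < Y, and the
  two integrals are exchanged.\<close>

lemma nn_integral_power_tail:
  fixes Y :: "'a \<Rightarrow> real"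
  assumes ps: "prob_space N" and Y[measurable]: "Y \<in> borel_measurable N"
    and nn: "\<And>\<omega>. \<omega> \<in> space N \<Longrightarrow> 0 \<le> Y \<omega>"
  shows "(\<integral>\<^sup>+\<omega>. ennreal (Y \<omega> ^ Suc k) \<partial>N) =
    (\<integral>\<^sup>+x. ennreal (real (Suc k) * x ^ k * measure N {\<omega>\<in>space N. x < Y \<omega>}) * indicator {0..} x \<partial>lborel)"
proof -
  interpret prob_space N by fact
  interpret pair_sigma_finite N lborel
    by (simp add: pair_sigma_finite_def sigma_finite_measure_axioms lborel.sigma_finite_measure_axioms)
  define h where "h \<omega> x = ennreal (real (Suc k) * x ^ k) * (indicator {0..} x * (if x < Y \<omega> then 1 else 0))"
    for \<omega> x
  have h: "case_prod h \<in> borel_measurable (N \<Otimes>\<^sub>M lborel)"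
    unfolding h_def by measurable
  have "(\<integral>\<^sup>+\<omega>. ennreal (Y \<omega> ^ Suc k) \<partial>N) = (\<integral>\<^sup>+\<omega>. (\<integral>\<^sup>+x. h \<omega> x \<partial>lborel) \<partial>N)"
  proof (intro nn_integral_cong)
    fix \<omega> assume w: "\<omega> \<in> space N"
    have "(\<integral>\<^sup>+x. h \<omega> x \<partial>lborel)
      = (\<integral>\<^sup>+x. ennreal (real (Suc k) * x ^ k) * indicator {0..Y \<omega>} x \<partial>lborel)"
      by (intro nn_integral_cong_AE, use AE_lborel_singleton[of "Y \<omega>"] in eventually_elim)
        (auto simp: h_def indicator_def)
    also have "\<dots> = ennreal (Y \<omega> ^ Suc k - 0 ^ Suc k)"
    proof (rule nn_integral_FTC_Icc)
      show "DERIV (\<lambda>x. x ^ Suc k) x :> real (Suc k) * x ^ k" for x :: real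
        using DERIV_pow[of "Suc k" x] by simp
    qed (use nn[OF w] in auto)
    finally show "ennreal (Y \<omega> ^ Suc k) = (\<integral>\<^sup>+x. h \<omega> x \<partial>lborel)" by simp
  qed
  also have "\<dots> = (\<integral>\<^sup>+x. (\<integral>\<^sup>+\<omega>. h \<omega> x \<partial>N) \<partial>lborel)"
    by (rule Fubini'[OF h, symmetric])
  also have "\<dots> = (\<integral>\<^sup>+x. ennreal (real (Suc k) * x ^ k * measure N {\<omega>\<in>space N. x < Y \<omega>}) * indicator {0..} x \<partial>lborel)"
  proof (intro nn_integral_cong)
    fix x :: real
    have "(\<integral>\<^sup>+\<omega>. h \<omega> x \<partial>N) = (\<integral>\<^sup>+\<omega>. ennreal (real (Suc k) * x ^ k) * indicator {0..} x
        * indicator {\<omega>\<in>space N. x < Y \<omega>} \<omega> \<partial>N)"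
      by (intro nn_integral_cong) (auto simp: h_def indicator_def)
    also have "\<dots> = ennreal (real (Suc k) * x ^ k) * indicator {0..} x * emeasure N {\<omega>\<in>space N. x < Y \<omega>}"
      by (intro nn_integral_cmult_indicator) measurable
    also have "\<dots> = ennreal (real (Suc k) * x ^ k * measure N {\<omega>\<in>space N. x < Y \<omega>}) * indicator {0..} x"
      by (auto simp: emeasure_eq_measure ennreal_mult indicator_def)
    finally show "(\<integral>\<^sup>+\<omega>. h \<omega> x \<partial>N)
      = ennreal (real (Suc k) * x ^ k * measure N {\<omega>\<in>space N. x < Y \<omega>}) * indicator {0..} x" .
  qed
  finally show ?thesis .
qed

lemma tail_borel_measurable:
  fixes Y :: "'a \<Rightarrow> real"
  assumes "prob_space N" "Y \<in> borel_measurable N"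
  shows "(\<lambda>x. measure N {\<omega>\<in>space N. x < Y \<omega>}) \<in> borel_measurable borel"
proof -
  interpret prob_space N by fact
  have "mono (\<lambda>x. - measure N {\<omega>\<in>space N. x < Y \<omega>})"
    using assms(2) by (intro monoI le_imp_neg_le finite_measure_mono) auto
  then have "(\<lambda>x. - (- measure N {\<omega>\<in>space N. x < Y \<omega>})) \<in> borel_measurable borel"
    by (intro borel_measurable_uminus borel_measurable_mono)
  then show ?thesis by simp
qed

text \<open>The variables live on different spaces, so dominated convergence is applied to their
  tails on the half-line, through the layer-cake formula.\<close>

lemma exponential_moment_limit:
  fixes Y :: "nat \<Rightarrow> 'a \<Rightarrow> real"
  assumes rv: "eventually (\<lambda>n. prob_space (N n) \<and> Y n \<in> borel_measurable (N n)
      \<and> (\<forall>\<omega>\<in>space (N n). 0 \<le> Y n \<omega>)) sequentially"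
    and tail: "\<And>x. 0 \<le> x \<Longrightarrow> (\<lambda>n. measure (N n) {\<omega>\<in>space (N n). x < Y n \<omega>}) \<longlonglongrightarrow> exp (- x)"
    and dom: "eventually (\<lambda>n. \<forall>x\<ge>0. measure (N n) {\<omega>\<in>space (N n). x < Y n \<omega>} \<le> C * exp (- (x / 2))) sequentially"
  shows "(\<lambda>n. \<integral>\<^sup>+\<omega>. ennreal (Y n \<omega> ^ Suc k) \<partial>N n) \<longlonglongrightarrow> ennreal (fact (Suc k))"
proof -
  \<comment> \<open>Dominated convergence asks for its bounds at every index, so the sequence is
    shifted to where they hold.\<close>
  obtain n0 where n0: "\<And>n. n \<ge> n0 \<Longrightarrow> prob_space (N n) \<and> Y n \<in> borel_measurable (N n)
      \<and> (\<forall>\<omega>\<in>space (N n). 0 \<le> Y n \<omega>)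
      \<and> (\<forall>x\<ge>0. measure (N n) {\<omega>\<in>space (N n). x < Y n \<omega>} \<le> C * exp (- (x / 2)))"
    using eventually_conj[OF rv dom] by (auto simp: eventually_sequentially)
  define G where "G n x = measure (N (n + n0)) {\<omega>\<in>space (N (n + n0)). x < Y (n + n0) \<omega>}" for n x
  have G[measurable]: "G n \<in> borel_measurable borel" for n
    unfolding G_def using n0[of "n + n0"] by (intro tail_borel_measurable) auto
  have "measure (N n0) {\<omega>\<in>space (N n0). 0 < Y n0 \<omega>} \<le> C * exp (- (0 / 2))"
    using n0[of n0] by blast
  then have "0 \<le> C * exp (- (0 / 2))"
    by (rule order_trans[OF measure_nonneg])
  then have C: "C \<ge> 0" by simp
  have "(\<lambda>n. \<integral>\<^sup>+x. ennreal (real (Suc k) * x ^ k * G n x) * indicator {0..} x \<partial>lborel)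
     \<longlonglongrightarrow> (\<integral>\<^sup>+x. ennreal (real (Suc k) * x ^ k * exp (- x)) * indicator {0..} x \<partial>lborel)"
  proof (rule nn_integral_dominated_convergence)
    \<comment> \<open>The majorant is written with the exponential density of rate 1/2, whose
      moments are known; the 2 undoes the factor 1/2 of that density.\<close>
    let ?w = "\<lambda>x. ennreal (real (Suc k) * C * 2) * ennreal (exponential_density (1 / 2) x * x ^ k)"
    show "AE x in lborel. ennreal (real (Suc k) * x ^ k * G n x) * indicator {0..} x \<le> ?w x" for n
    proof (intro AE_I2)
      fix x :: real
      show "ennreal (real (Suc k) * x ^ k * G n x) * indicator {0..} x \<le> ?w x"
      proof (cases "x \<ge> 0")
        case True
        have "real (Suc k) * x ^ k * G n x \<le> real (Suc k) * x ^ k * (C * exp (- (x / 2)))"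
          using True n0[of "n + n0"] unfolding G_def by (intro mult_left_mono) auto
        also have "\<dots> = real (Suc k) * C * 2 * (exponential_density (1 / 2) x * x ^ k)"
          using True by (simp add: erlang_density_def)
        finally have "ennreal (real (Suc k) * x ^ k * G n x)
            \<le> ennreal (real (Suc k) * C * 2 * (exponential_density (1 / 2) x * x ^ k))"
          by (rule ennreal_leI)
        then show ?thesis using True C by (simp add: ennreal_mult)
      qed simp
    qed
    have "(\<integral>\<^sup>+x. ?w x \<partial>lborel) = ennreal (real (Suc k) * C * 2) * ennreal (fact (0 + k) / (fact 0 * (1 / 2) ^ k))"
      by (subst nn_integral_cmult) (auto simp: nn_integral_erlang_ith_moment)
    then show "(\<integral>\<^sup>+x. ?w x \<partial>lborel) < \<infinity>" by (simp add: ennreal_mult_less_top)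
    show "AE x in lborel. (\<lambda>n. ennreal (real (Suc k) * x ^ k * G n x) * indicator {0..} x)
       \<longlonglongrightarrow> ennreal (real (Suc k) * x ^ k * exp (- x)) * indicator {0..} x"
    proof (intro AE_I2)
      fix x :: real
      show "(\<lambda>n. ennreal (real (Suc k) * x ^ k * G n x) * indicator {0..} x)
         \<longlonglongrightarrow> ennreal (real (Suc k) * x ^ k * exp (- x)) * indicator {0..} x"
      proof (cases "x \<ge> 0")
        case True
        then have "(\<lambda>n. G n x) \<longlonglongrightarrow> exp (- x)"
          unfolding G_def by (intro LIMSEQ_ignore_initial_segment[OF tail])
        then show ?thesis using True by (auto intro!: tendsto_intros)
      qed simp
    qed
  qed measurable
  moreover have "(\<integral>\<^sup>+x. ennreal (real (Suc k) * x ^ k * exp (- x)) * indicator {0..} x \<partial>lborel) = ennreal (fact (Suc k))"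
  proof -
    have "(\<integral>\<^sup>+x. ennreal (real (Suc k) * x ^ k * exp (- x)) * indicator {0..} x \<partial>lborel)
      = (\<integral>\<^sup>+x. ennreal (real (Suc k)) * (ennreal (x ^ k * exp (- x)) * indicator {0..} x) \<partial>lborel)"
      by (intro nn_integral_cong) (auto simp: indicator_def ennreal_mult mult.assoc simp del: of_nat_Suc)
    also have "\<dots> = ennreal (real (Suc k)) * ennreal (real_of_nat (fact k))"
      by (subst nn_integral_cmult) (auto simp: nn_intergal_power_times_exp_Ici simp del: of_nat_Suc)
    also have "\<dots> = ennreal (fact (Suc k))"
      by (subst ennreal_mult[symmetric]) (auto simp del: of_nat_Suc simp: fact_Suc)
    finally show ?thesis .
  qed
  moreover have "(\<integral>\<^sup>+x. ennreal (real (Suc k) * x ^ k * G n x) * indicator {0..} x \<partial>lborel)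
     = (\<integral>\<^sup>+\<omega>. ennreal (Y (n + n0) \<omega> ^ Suc k) \<partial>N (n + n0))" for n
    unfolding G_def using n0[of "n + n0"] by (intro nn_integral_power_tail[symmetric]) auto
  ultimately have "(\<lambda>n. \<integral>\<^sup>+\<omega>. ennreal (Y (n + n0) \<omega> ^ Suc k) \<partial>N (n + n0)) \<longlonglongrightarrow> ennreal (fact (Suc k))"
    by (simp only:)
  then show ?thesis by (rule LIMSEQ_offset)
qed

lemma exponential_weak_limit:
  fixes Y :: "nat \<Rightarrow> 'a \<Rightarrow> real"
  assumes rv: "eventually (\<lambda>n. prob_space (N n) \<and> Y n \<in> borel_measurable (N n)
      \<and> (\<forall>\<omega>\<in>space (N n). 0 \<le> Y n \<omega>)) sequentially"
    and tail: "\<And>x. 0 \<le> x \<Longrightarrow> (\<lambda>n. measure (N n) {\<omega>\<in>space (N n). x < Y n \<omega>}) \<longlonglongrightarrow> exp (- x)"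
  shows "weak_conv_m (\<lambda>n. distr (N n) borel (Y n)) (density lborel (exponential_density 1))"
  unfolding weak_conv_m_def weak_conv_def
proof safe
  fix x :: real
  have cdf: "cdf (density lborel (exponential_density 1)) x = (if x < 0 then 0 else 1 - exp (- x))"
    unfolding cdf_def measure_def
    by (subst emeasure_erlang_density) (auto simp: erlang_CDF_def)
  show "(\<lambda>n. cdf (distr (N n) borel (Y n)) x) \<longlonglongrightarrow> cdf (density lborel (exponential_density 1)) x"
  proof (cases "x < 0")
    case True
    have "eventually (\<lambda>n. cdf (distr (N n) borel (Y n)) x = 0) sequentially"
      using rv
    proof eventually_elim
      case (elim n)
      have "Y n -` {..x} \<inter> space (N n) = {}" using elim True by fastforce
      then show ?case unfolding cdf_def using elim by (subst measure_distr) auto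
    qed
    then show ?thesis using True cdf by (simp add: tendsto_eventually)
  next
    case False
    have "eventually (\<lambda>n. 1 - measure (N n) {\<omega>\<in>space (N n). x < Y n \<omega>} = cdf (distr (N n) borel (Y n)) x) sequentially"
      using rv
    proof eventually_elim
      case (elim n)
      then interpret prob_space "N n" by simp
      have [measurable]: "Y n \<in> borel_measurable (N n)" using elim by simp
      have "cdf (distr (N n) borel (Y n)) x = prob (space (N n) - {\<omega>\<in>space (N n). x < Y n \<omega>})"
        unfolding cdf_def by (subst measure_distr) (auto intro!: arg_cong[where f = prob])
      also have "\<dots> = 1 - prob {\<omega>\<in>space (N n). x < Y n \<omega>}"
        by (rule prob_compl) measurable
      finally show ?case by simp
    qed
    moreover have "(\<lambda>n. 1 - measure (N n) {\<omega>\<in>space (N n). x < Y n \<omega>}) \<longlonglongrightarrow> 1 - exp (- x)"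
      using tail False by (intro tendsto_intros) auto
    ultimately show ?thesis using False cdf Lim_transform_eventually by fastforce
  qed
qed

section \<open>From word averages to the coupon sequence\<close>

lemma word_mean_eq_sum:
  "word_mean n t f = (\<Sum>w | set w \<subseteq> {1..n} \<and> length w = t. f w) / real n ^ t"
proof (induction t arbitrary: f)
  case 0
  have "{w. set w \<subseteq> {1..n} \<and> length w = 0} = {[]}" by auto
  then show ?case by simp
next
  case (Suc t)
  let ?W = "\<lambda>t. {w. set w \<subseteq> {1..n} \<and> length w = t}"
  have "(\<Sum>w\<in>?W (Suc t). f w) = (\<Sum>(w, c)\<in>?W t \<times> {1..n}. f (c # w))"
    unfolding lists_length_Suc_eq
    by (subst sum.reindex) (auto simp: inj_on_def case_prod_beta)
  also have "\<dots> = (\<Sum>c=1..n. \<Sum>w\<in>?W t. f (c # w))"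
    by (subst sum.swap, subst sum.cartesian_product) simp
  finally show ?case
    by (simp add: Suc.IH sum_divide_distrib[symmetric] del: of_nat_Suc)
qed

context
  fixes \<Omega> :: "'a measure" and n :: nat and X :: "nat \<Rightarrow> 'a \<Rightarrow> nat"
  assumes n: "n \<ge> 1" and X: "uniform_coupons \<Omega> n X"
begin

interpretation prob_space \<Omega>
  using X by (simp add: uniform_coupons_def)

lemma coupon_measurable: "i \<ge> 1 \<Longrightarrow> X i \<in> \<Omega> \<rightarrow>\<^sub>M count_space UNIV"
  using X by (auto simp: uniform_coupons_def indep_vars_def)

lemma coupon_prob:
  assumes "i \<ge> 1" "c \<in> {1..n}"
  shows "prob (X i -` {c} \<inter> space \<Omega>) = 1 / real n"
proof -
  have "prob (X i -` {c} \<inter> space \<Omega>) = measure (distr \<Omega> (count_space UNIV) (X i)) {c}"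
    using assms by (subst measure_distr[OF coupon_measurable]) auto
  also have "\<dots> = pmf (pmf_of_set {1..n}) c"
    using X assms by (simp add: uniform_coupons_def measure_pmf_single)
  also have "\<dots> = 1 / real n"
    using n assms by (subst pmf_of_set) auto
  finally show ?thesis .
qed

lemma coupon_AE_range: "AE \<omega> in \<Omega>. \<forall>i\<ge>1. X i \<omega> \<in> {1..n}"
proof -
  have "AE \<omega> in \<Omega>. X i \<omega> \<in> {1..n}" if "i \<ge> 1" for i
  proof -
    have "AE c in distr \<Omega> (count_space UNIV) (X i). c \<in> {1..n}"
    proof -
      have *: "distr \<Omega> (count_space UNIV) (X i) = measure_pmf (pmf_of_set {1..n})"
        using X that by (simp add: uniform_coupons_def)
      show ?thesis unfolding * AE_measure_pmf_iff using n by (simp add: set_pmf_of_set)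
    qed
    then show ?thesis
      by (subst (asm) AE_distr_iff[OF coupon_measurable[OF that]]) auto
  qed
  then show ?thesis by (simp add: AE_all_countable AE_ball_countable' all_conj_distrib)
qed

lemma coupon_word_measurable:
  "{\<omega>\<in>space \<Omega>. P (map (\<lambda>i. X i \<omega>) [1..<Suc t])} \<in> events"
proof -
  have "(\<lambda>\<omega>. map (\<lambda>i. X i \<omega>) [1..<Suc t]) \<in> \<Omega> \<rightarrow>\<^sub>M count_space UNIV"
  proof (induction t)
    case (Suc t)
    have "(\<lambda>\<omega>. (map (\<lambda>i. X i \<omega>) [1..<Suc t], X (Suc t) \<omega>)) \<in> \<Omega> \<rightarrow>\<^sub>M count_space UNIV \<Otimes>\<^sub>M count_space UNIV"
      by (intro measurable_Pair Suc coupon_measurable) simp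
    then have "(\<lambda>\<omega>. (map (\<lambda>i. X i \<omega>) [1..<Suc t], X (Suc t) \<omega>)) \<in> \<Omega> \<rightarrow>\<^sub>M count_space UNIV"
      by (simp add: pair_measure_countable)
    then have "(\<lambda>(u, c). u @ [c]) \<circ> (\<lambda>\<omega>. (map (\<lambda>i. X i \<omega>) [1..<Suc t], X (Suc t) \<omega>)) \<in> \<Omega> \<rightarrow>\<^sub>M count_space UNIV"
      by (rule measurable_comp) simp
    then show ?case by (simp add: comp_def)
  qed simp
  from measurable_sets[OF this, of "Collect P"] show ?thesis
    by (simp add: vimage_def Int_def conj_commute)
qed

lemma coupon_word_prob:
  assumes w: "length w = t" "set w \<subseteq> {1..n}"
  shows "prob {\<omega>\<in>space \<Omega>. map (\<lambda>i. X i \<omega>) [1..<Suc t] = w} = 1 / real n ^ t"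
proof (cases "t = 0")
  case True
  then show ?thesis using w by (simp add: prob_space)
next
  case False
  have "{\<omega>\<in>space \<Omega>. map (\<lambda>i. X i \<omega>) [1..<Suc t] = w} = (\<Inter>j\<in>{1..t}. X j -` {w ! (j - 1)} \<inter> space \<Omega>)"
  proof (intro set_eqI iffI)
    fix \<omega> assume a: "\<omega> \<in> {\<omega>\<in>space \<Omega>. map (\<lambda>i. X i \<omega>) [1..<Suc t] = w}"
    have "X j \<omega> = w ! (j - 1)" if "j \<in> {1..t}" for j
      using arg_cong[of _ _ "\<lambda>v. v ! (j - 1)"] a that by (auto simp del: upt_Suc)
    then show "\<omega> \<in> (\<Inter>j\<in>{1..t}. X j -` {w ! (j - 1)} \<inter> space \<Omega>)" using a by auto
  next
    fix \<omega> assume a: "\<omega> \<in> (\<Inter>j\<in>{1..t}. X j -` {w ! (j - 1)} \<inter> space \<Omega>)"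
    then have "X (Suc i) \<omega> = w ! i" if "i < t" for i
      using that by (force dest: bspec[of _ _ "Suc i"])
    then show "\<omega> \<in> {\<omega>\<in>space \<Omega>. map (\<lambda>i. X i \<omega>) [1..<Suc t] = w}"
      using a w False by (auto intro!: nth_equalityI simp del: upt_Suc)
  qed
  also have "prob \<dots> = (\<Prod>j\<in>{1..t}. prob (X j -` {w ! (j - 1)} \<inter> space \<Omega>))"
    using X False by (intro indep_varsD[where M' = "\<lambda>_. count_space UNIV" and I = "{1..}"])
      (auto simp: uniform_coupons_def)
  also have "\<dots> = (\<Prod>j\<in>{1..t}. 1 / real n)"
  proof (intro prod.cong coupon_prob)
    fix j assume "j \<in> {1..t}"
    then have "w ! (j - 1) \<in> set w" using w by (intro nth_mem) auto
    then show "w ! (j - 1) \<in> {1..n}" using w by blast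
  qed auto
  finally show ?thesis by (simp add: power_one_over)
qed

text \<open>Coupons lie in {1..n} only almost surely, so the event agrees with a finite union over
  words up to a null set.\<close>

lemma coupon_prob_eq_word_mean:
  "prob {\<omega>\<in>space \<Omega>. P (map (\<lambda>i. X i \<omega>) [1..<Suc t])} = word_mean n t (\<lambda>w. of_bool (P w))"
proof -
  let ?W = "{w. set w \<subseteq> {1..n} \<and> length w = t}"
  let ?m = "\<lambda>\<omega>. map (\<lambda>i. X i \<omega>) [1..<Suc t]"
  have fin: "finite ?W" by (rule finite_lists_length_eq) simp
  have fin': "finite {w\<in>?W. P w}" by (rule finite_subset[OF _ fin]) auto
  have "prob {\<omega>\<in>space \<Omega>. P (?m \<omega>)} = prob (\<Union>w\<in>{w\<in>?W. P w}. {\<omega>\<in>space \<Omega>. ?m \<omega> = w})"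
  proof (rule measure_eq_AE)
    show "AE \<omega> in \<Omega>. (\<omega> \<in> {\<omega>\<in>space \<Omega>. P (?m \<omega>)}) \<longleftrightarrow> (\<omega> \<in> (\<Union>w\<in>{w\<in>?W. P w}. {\<omega>\<in>space \<Omega>. ?m \<omega> = w}))"
      using coupon_AE_range by eventually_elim (auto simp del: upt_Suc)
    show "(\<Union>w\<in>{w\<in>?W. P w}. {\<omega>\<in>space \<Omega>. ?m \<omega> = w}) \<in> events"
      by (intro sets.finite_UN coupon_word_measurable fin')
  qed (rule coupon_word_measurable)
  also have "\<dots> = (\<Sum>w\<in>{w\<in>?W. P w}. prob {\<omega>\<in>space \<Omega>. ?m \<omega> = w})"
    using coupon_word_measurable
    by (intro finite_measure_finite_Union fin') (auto simp: disjoint_family_on_def simp del: upt_Suc)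
  also have "\<dots> = (\<Sum>w\<in>{w\<in>?W. P w}. 1 / real n ^ t)"
    by (intro sum.cong coupon_word_prob) auto
  also have "\<dots> = (\<Sum>w\<in>?W. of_bool (P w)) / real n ^ t"
    using sum.inter_filter[OF fin, of "\<lambda>_. 1 / real n ^ t" P]
    by (simp add: sum_divide_distrib of_bool_def if_distrib[of "\<lambda>x. x / real n ^ t"] cong: if_cong)
  finally show ?thesis by (simp only: word_mean_eq_sum)
qed

end

section \<open>The completion time\<close>

lemma completion_time_cases:
  obtains "completion_time n M x = \<top>" "\<And>t. n \<le> t \<Longrightarrow> x ` {max 1 (t + 1 - M)..t} \<noteq> {1..n}"
  | s where "n \<le> s" "x ` {max 1 (s + 1 - M)..s} = {1..n}" "completion_time n M x = of_nat s"
      "\<And>t. n \<le> t \<Longrightarrow> x ` {max 1 (t + 1 - M)..t} = {1..n} \<Longrightarrow> s \<le> t"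
proof (cases "\<exists>t. n \<le> t \<and> x ` {max 1 (t + 1 - M)..t} = {1..n}")
  case False
  then have "{t. n \<le> t \<and> x ` {max 1 (t + 1 - M)..t} = {1..n}} = {}" by blast
  then have "completion_time n M x = \<top>" unfolding completion_time_def by (simp only: image_empty Inf_empty)
  then show ?thesis using False that(1) by blast
next
  case True
  let ?P = "\<lambda>t. n \<le> t \<and> x ` {max 1 (t + 1 - M)..t} = {1..n}"
  define s where "s = (LEAST t. ?P t)"
  have s: "?P s" unfolding s_def using True by (rule LeastI_ex)
  have least: "s \<le> t" if "?P t" for t unfolding s_def using that by (rule Least_le)
  have "completion_time n M x = of_nat s"
    unfolding completion_time_def using s least by (intro antisym INF_lower INF_greatest) auto
  then show ?thesis using s least that(2) by blast
qed

lemma window_image: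
  "x ` {max 1 (t + 1 - M)..t} = set (drop (t - M) (map x [1..<Suc t]))"
proof -
  have "{max 1 (t + 1 - M)..t} = set [1 + (t - M)..<Suc t]" by auto
  then show ?thesis by (simp add: drop_map drop_upt del: upt_Suc set_upt)
qed

lemma full_at_map:
  assumes "i + M \<le> t"
  shows "full_at n M i (map x [1..<Suc t]) \<longleftrightarrow> {1..n} \<subseteq> x ` {i + 1..i + M}"
proof -
  have "take M (drop i (map x [1..<Suc t])) = map x [1 + i..<1 + i + M]"
    using assms by (simp add: drop_map take_map drop_upt take_upt del: upt_Suc)
  moreover have "set [1 + i..<1 + i + M] = {i + 1..i + M}" by auto
  ultimately show ?thesis
    by (simp add: full_at_def full_word_def del: upt_Suc set_upt)
qed

lemma completion_time_gt_iff:
  assumes range: "\<forall>i\<ge>1. x i \<in> {1..n}" and "n \<le> M" "M \<le> t"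
  shows "of_nat t < completion_time n M x \<longleftrightarrow> no_full n M (map x [1..<Suc t])"
proof
  assume gt: "of_nat t < completion_time n M x"
  show "no_full n M (map x [1..<Suc t])"
    unfolding no_full_def
  proof safe
    fix i assume i: "i + M \<le> length (map x [1..<Suc t])" "full_at n M i (map x [1..<Suc t])"
    then have it: "i + M \<le> t" by (simp del: upt_Suc)
    have "{1..n} \<subseteq> x ` {i + 1..i + M}" using i(2) full_at_map[OF it] by blast
    moreover have "x ` {i + 1..i + M} \<subseteq> {1..n}" using range by auto
    moreover have "{max 1 (i + M + 1 - M)..i + M} = {i + 1..i + M}" by simp
    ultimately have "x ` {max 1 (i + M + 1 - M)..i + M} = {1..n}" by (simp only: subset_antisym)
    then have "completion_time n M x \<le> of_nat (i + M)"
      unfolding completion_time_def using assms by (intro INF_lower) simp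
    also have "\<dots> \<le> of_nat t" using it by (simp only: of_nat_le_iff)
    finally show False using gt by simp
  qed
next
  assume nf: "no_full n M (map x [1..<Suc t])"
  show "of_nat t < completion_time n M x"
  proof (cases rule: completion_time_cases[of n M x])
    case 1
    then show ?thesis by (simp add: of_nat_less_top)
  next
    case (2 s)
    have "t < s"
    proof (rule ccontr)
      assume "\<not> t < s"
      \<comment> \<open>Truncated subtraction sends every s < M to window 0.\<close>
      define i where "i = s - M"
      have i: "i + M \<le> t" using \<open>\<not> t < s\<close> assms by (simp add: i_def)
      have "{max 1 (s + 1 - M)..s} \<subseteq> {i + 1..i + M}" by (auto simp: i_def)
      then have "{1..n} \<subseteq> x ` {i + 1..i + M}" using 2(2) by blast
      then have "full_at n M i (map x [1..<Suc t])" using full_at_map[OF i] by blast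
      then show False using nf i by (simp add: no_full_def)
    qed
    then show ?thesis using 2 by simp
  qed
qed

context
  fixes \<Omega> :: "'a measure" and n M :: nat and X :: "nat \<Rightarrow> 'a \<Rightarrow> nat" and T :: "'a \<Rightarrow> ennreal"
  assumes n: "n \<ge> 1" and M: "n \<le> M" and X: "uniform_coupons \<Omega> n X"
  defines "T \<equiv> \<lambda>\<omega>. completion_time n M (\<lambda>t. X t \<omega>)"
begin

interpretation prob_space \<Omega>
  using X by (simp add: uniform_coupons_def)

lemma completion_time_measurable: "T \<in> borel_measurable \<Omega>"
proof -
  let ?P = "\<lambda>t \<omega>. n \<le> t \<and> set (drop (t - M) (map (\<lambda>i. X i \<omega>) [1..<Suc t])) = {1..n}"
  have P: "{\<omega>\<in>space \<Omega>. ?P t \<omega>} \<in> events" for t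
    by (rule coupon_word_measurable[OF n X])
  \<comment> \<open>The index set of the infimum depends on \<omega>. Giving the excluded t the
    value \<top> turns it into a countable infimum of measurable functions.\<close>
  have INF_Collect: "(INF t\<in>{t. Q t}. f t) = (INF t. if Q t then f t else \<top>)"
    for Q :: "nat \<Rightarrow> bool" and f :: "nat \<Rightarrow> ennreal"
  proof (intro antisym INF_greatest)
    fix t assume "t \<in> {t. Q t}"
    then show "(INF t. if Q t then f t else \<top>) \<le> f t"
      using INF_lower[of t UNIV "\<lambda>t. if Q t then f t else \<top>"] by simp
  qed (auto intro: INF_lower)
  have T_eq: "T = (\<lambda>\<omega>. INF t. if ?P t \<omega> then of_nat t else \<top>)"
    unfolding T_def completion_time_def window_image INF_Collect ..
  show ?thesis
    unfolding T_eq by (intro borel_measurable_INF measurable_If P borel_measurable_const) simp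
qed

lemma completion_time_tail:
  assumes "M \<le> t"
  shows "prob {\<omega>\<in>space \<Omega>. of_nat t < T \<omega>} = survival n M t"
proof -
  have [measurable]: "T \<in> borel_measurable \<Omega>" by (rule completion_time_measurable)
  have "prob {\<omega>\<in>space \<Omega>. of_nat t < T \<omega>} = prob {\<omega>\<in>space \<Omega>. no_full n M (map (\<lambda>i. X i \<omega>) [1..<Suc t])}"
  proof (rule measure_eq_AE)
    show "AE \<omega> in \<Omega>. \<omega> \<in> {\<omega>\<in>space \<Omega>. of_nat t < T \<omega>}
        \<longleftrightarrow> \<omega> \<in> {\<omega>\<in>space \<Omega>. no_full n M (map (\<lambda>i. X i \<omega>) [1..<Suc t])}"
      using coupon_AE_range[OF n X]
    proof eventually_elim
      case (elim \<omega>)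
      then show ?case
        using completion_time_gt_iff[of "\<lambda>i. X i \<omega>" n M t] M assms by (simp add: T_def del: upt_Suc)
    qed
    show "{\<omega>\<in>space \<Omega>. of_nat t < T \<omega>} \<in> events" by measurable
  qed (rule coupon_word_measurable[OF n X])
  also have "\<dots> = survival n M t"
    unfolding survival_def by (rule coupon_prob_eq_word_mean[OF n X])
  finally show ?thesis .
qed

text \<open>For t < M the equality of \<open>completion_time_tail\<close> can fail: survival is 1
  for lack of complete windows, while T may already have occurred.\<close>

lemma completion_time_tail_bounds:
  "prob {\<omega>\<in>space \<Omega>. of_nat t < T \<omega>} \<le> survival n M t"
  "survival n M (max t M) \<le> prob {\<omega>\<in>space \<Omega>. of_nat t < T \<omega>}"
proof -
  have [measurable]: "T \<in> borel_measurable \<Omega>" by (rule completion_time_measurable)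
  have "survival n M t = 1" if "t < M"
  proof -
    have "survival n M t = word_mean n t (\<lambda>w. 1)"
      unfolding survival_def using that by (intro word_mean_cong) (simp add: no_full_def)
    then show ?thesis using word_mean_const[OF n] by simp
  qed
  then show "prob {\<omega>\<in>space \<Omega>. of_nat t < T \<omega>} \<le> survival n M t"
    using completion_time_tail[of t] by (cases "t < M") auto
  have "survival n M (max t M) = prob {\<omega>\<in>space \<Omega>. of_nat (max t M) < T \<omega>}"
    by (intro completion_time_tail[symmetric]) simp
  also have "\<dots> \<le> prob {\<omega>\<in>space \<Omega>. of_nat t < T \<omega>}"
  proof (intro finite_measure_mono)
    have "(of_nat t :: ennreal) \<le> of_nat (max t M)" by (intro of_nat_mono) simp
    then show "{\<omega>\<in>space \<Omega>. of_nat (max t M) < T \<omega>} \<subseteq> {\<omega>\<in>space \<Omega>. of_nat t < T \<omega>}"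
      by (blast intro: le_less_trans)
    show "{\<omega>\<in>space \<Omega>. of_nat t < T \<omega>} \<in> events" by measurable
  qed
  finally show "survival n M (max t M) \<le> prob {\<omega>\<in>space \<Omega>. of_nat t < T \<omega>}" .
qed

lemma completion_time_AE_finite:
  assumes "(\<lambda>t. survival n M t) \<longlonglongrightarrow> 0"
  shows "AE \<omega> in \<Omega>. T \<omega> < \<infinity>"
proof -
  have [measurable]: "T \<in> borel_measurable \<Omega>" by (rule completion_time_measurable)
  have "prob {\<omega>\<in>space \<Omega>. T \<omega> = \<infinity>} \<le> 0"
  proof (rule LIMSEQ_le_const[OF assms], intro exI allI impI)
    fix t
    have "prob {\<omega>\<in>space \<Omega>. T \<omega> = \<infinity>} \<le> prob {\<omega>\<in>space \<Omega>. of_nat t < T \<omega>}"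
      by (intro finite_measure_mono) (auto simp: of_nat_less_top)
    also have "\<dots> \<le> survival n M t" by (rule completion_time_tail_bounds)
    finally show "prob {\<omega>\<in>space \<Omega>. T \<omega> = \<infinity>} \<le> survival n M t" .
  qed
  then have "prob {\<omega>\<in>space \<Omega>. T \<omega> = \<infinity>} = 0" using measure_nonneg by (rule antisym)
  then have "AE \<omega> in \<Omega>. \<omega> \<notin> {\<omega>\<in>space \<Omega>. T \<omega> = \<infinity>}"
    by (subst (asm) prob_eq_0) auto
  then show ?thesis using AE_space by eventually_elim (auto simp: top.not_eq_extremum)
qed

text \<open>Finite values of T are integers, so x / r may be replaced by its floor. Finiteness
  matters because \<open>enn2real\<close> sends \<infinity> to 0.\<close>

lemma scaled_completion_time_tail:
  assumes fin: "AE \<omega> in \<Omega>. T \<omega> < \<infinity>" and r: "r > 0" and x: "x \<ge> 0"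
  shows "prob {\<omega>\<in>space \<Omega>. x < r * enn2real (T \<omega>)} = prob {\<omega>\<in>space \<Omega>. of_nat (nat \<lfloor>x / r\<rfloor>) < T \<omega>}"
proof (rule measure_eq_AE)
  have [measurable]: "T \<in> borel_measurable \<Omega>" by (rule completion_time_measurable)
  show "{\<omega>\<in>space \<Omega>. x < r * enn2real (T \<omega>)} \<in> events"
    "{\<omega>\<in>space \<Omega>. of_nat (nat \<lfloor>x / r\<rfloor>) < T \<omega>} \<in> events"
    by measurable
  show "AE \<omega> in \<Omega>. \<omega> \<in> {\<omega>\<in>space \<Omega>. x < r * enn2real (T \<omega>)}
      \<longleftrightarrow> \<omega> \<in> {\<omega>\<in>space \<Omega>. of_nat (nat \<lfloor>x / r\<rfloor>) < T \<omega>}"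
    using fin
  proof eventually_elim
    case (elim \<omega>)
    then obtain s where s: "T \<omega> = of_nat s"
      unfolding T_def by (cases rule: completion_time_cases[of n M "\<lambda>t. X t \<omega>"]) auto
    have "x < r * real s \<longleftrightarrow> x / r < real s"
      using r by (simp add: pos_divide_less_eq mult.commute)
    also have "\<dots> \<longleftrightarrow> nat \<lfloor>x / r\<rfloor> < s"
      using x r by (simp add: nat_less_iff floor_less_iff)
    finally show ?case by (simp add: s)
  qed
qed

end

section \<open>Scaling by the entry rate, and the limit theorem\<close>

context admissible_windows
begin

lemma rate_0: "rate \<longlonglongrightarrow> 0"
proof (rule tendsto_sandwich[OF _ _ tendsto_const[of 0] rate_block])
  show "eventually (\<lambda>n. 0 \<le> rate n) sequentially"
    using eventually_full_prob_le by eventually_elim simp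
  show "eventually (\<lambda>n. rate n \<le> rate n * real (block n)) sequentially"
    using eventually_full_prob_le eventually_M_ge[of 1]
  proof eventually_elim
    case (elim n)
    then have "1 \<le> real (block n)" by simp
    then show ?case using elim mult_left_mono[of 1 "real (block n)" "rate n"] by simp
  qed
qed

lemma rate_M_0: "(\<lambda>n. rate n * real (M n)) \<longlonglongrightarrow> 0"
proof (rule tendsto_sandwich[OF _ _ tendsto_const[of 0] rate_block])
  show "eventually (\<lambda>n. 0 \<le> rate n * real (M n)) sequentially"
    using eventually_full_prob_le by eventually_elim simp
  show "eventually (\<lambda>n. rate n * real (M n) \<le> rate n * real (block n)) sequentially"
    using eventually_full_prob_le eventually_M_ge[of 1]
  proof eventually_elim
    case (elim n)
    then have "real (M n) \<le> real (block n)" by (simp add: power2_eq_square)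
    then show ?case using elim by (intro mult_left_mono) auto
  qed
qed

lemma rate_floor:
  assumes "x \<ge> 0"
  shows "(\<lambda>n. rate n * real (nat \<lfloor>x / rate n\<rfloor>)) \<longlonglongrightarrow> x"
proof (rule tendsto_sandwich)
  have "(\<lambda>n. x - rate n) \<longlonglongrightarrow> x - 0" by (intro tendsto_intros rate_0)
  then show "(\<lambda>n. x - rate n) \<longlonglongrightarrow> x" by simp
  show "(\<lambda>n. x) \<longlonglongrightarrow> x" by simp
  have *: "eventually (\<lambda>n. x - rate n \<le> rate n * real (nat \<lfloor>x / rate n\<rfloor>)
      \<and> rate n * real (nat \<lfloor>x / rate n\<rfloor>) \<le> x) sequentially"
    using eventually_full_prob_le
  proof eventually_elim
    case (elim n)
    have k: "real (nat \<lfloor>x / rate n\<rfloor>) \<le> x / rate n" "x / rate n - 1 \<le> real (nat \<lfloor>x / rate n\<rfloor>)"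
      using assms elim by (auto intro: less_imp_le)
    have "rate n * (x / rate n - 1) \<le> rate n * real (nat \<lfloor>x / rate n\<rfloor>)"
      "rate n * real (nat \<lfloor>x / rate n\<rfloor>) \<le> rate n * (x / rate n)"
      using k elim by (intro mult_left_mono; simp)+
    then show ?case using elim by (simp add: right_diff_distrib)
  qed
  show "eventually (\<lambda>n. x - rate n \<le> rate n * real (nat \<lfloor>x / rate n\<rfloor>)) sequentially"
    using * by eventually_elim simp
  show "eventually (\<lambda>n. rate n * real (nat \<lfloor>x / rate n\<rfloor>) \<le> x) sequentially"
    using * by eventually_elim simp
qed

end

theorem theorem6p1:
  fixes M :: "nat \<Rightarrow> nat"
    and \<Omega> :: "nat \<Rightarrow> 'a measure"
    and X :: "nat \<Rightarrow> nat \<Rightarrow> 'a \<Rightarrow> nat"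
    and T :: "nat \<Rightarrow> 'a \<Rightarrow> ennreal"
    and \<mu> :: "nat \<Rightarrow> real"
  assumes coupons: "\<And>n. n \<ge> 1 \<Longrightarrow> uniform_coupons (\<Omega> n) n (X n)"
    and M_ge: "eventually (\<lambda>n. n \<le> M n) sequentially"
    and M_le: "eventually (\<lambda>n. real (M n) \<le> real n * ln (real n)) sequentially"
    and lambda: "filterlim (\<lambda>n. coupon_lambda n (M n) / (ln (real (M n)))\<^sup>2) at_top sequentially"
  defines "T \<equiv> \<lambda>n \<omega>. completion_time n (M n) (\<lambda>t. X n t \<omega>)"
    and "\<mu> \<equiv> \<lambda>n. coupon_mu n (M n)"
  shows "(eventually (\<lambda>n. AE \<omega> in \<Omega> n. T n \<omega> < \<infinity>) sequentially) \<and>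
         weak_conv_m (\<lambda>n. distr (\<Omega> n) borel (\<lambda>\<omega>. \<mu> n * enn2real (T n \<omega>)))
           (density lborel (exponential_density 1)) \<and>
         (\<forall>r\<ge>1. (\<lambda>n. \<integral>\<^sup>+\<omega>. (ennreal (\<mu> n) * T n \<omega>) ^ r \<partial>\<Omega> n) \<longlonglongrightarrow> ennreal (fact r)) \<and>
         (\<lambda>n. prob_space.expectation (\<Omega> n) (\<lambda>\<omega>. enn2real (T n \<omega>))) \<sim>[sequentially] (\<lambda>n. 1 / \<mu> n) \<and>
         (\<lambda>n. prob_space.variance (\<Omega> n) (\<lambda>\<omega>. enn2real (T n \<omega>))) \<sim>[sequentially] (\<lambda>n. 1 / (\<mu> n)\<^sup>2)"
proof -
  interpret admissible_windows M
    using M_ge M_le lambda by unfold_locales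
  define Y where "Y n \<omega> = \<mu> n * enn2real (T n \<omega>)" for n \<omega>
  have good: "eventually (\<lambda>n. n \<ge> 1 \<and> n \<le> M n \<and> \<mu> n = rate n \<and> \<mu> n > 0) sequentially"
    using M_ge eventually_ge_at_top[of 1] eventually_full_prob_le
    by eventually_elim (auto simp: \<mu>_def entry_rate_eq_coupon_mu)
  have finite: "eventually (\<lambda>n. AE \<omega> in \<Omega> n. T n \<omega> < \<infinity>) sequentially"
    using good eventually_survival_le
  proof eventually_elim
    case (elim n)
    have "(\<lambda>t. survival n (M n) t) \<longlonglongrightarrow> 0"
    proof (rule tendsto_sandwich[OF _ _ tendsto_const[of 0]])
      have "filterlim (\<lambda>t. \<mu> n / 2 * real t) at_top sequentially"
        using elim by (intro filterlim_tendsto_pos_mult_at_top[OF tendsto_const] filterlim_real_sequentially) auto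
      then have "(\<lambda>t. exp (- (\<mu> n / 2 * real t))) \<longlonglongrightarrow> 0"
        by (intro filterlim_compose[OF exp_at_bot]) (simp add: filterlim_uminus_at_top)
      then have "(\<lambda>t. 2 * exp (- (\<mu> n / 2 * real t))) \<longlonglongrightarrow> 2 * 0"
        by (intro tendsto_intros)
      then show "(\<lambda>t. 2 * exp (- (rate n * real t / 2))) \<longlonglongrightarrow> 0" using elim by simp
    qed (use elim survival_nonneg in auto)
    then show ?case
      unfolding T_def using elim coupons by (intro completion_time_AE_finite) auto
  qed
  have meas: "eventually (\<lambda>n. prob_space (\<Omega> n) \<and> T n \<in> borel_measurable (\<Omega> n)) sequentially"
    using good
  proof eventually_elim
    case (elim n)
    then have "uniform_coupons (\<Omega> n) n (X n)" using coupons by simp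
    then show ?case
      using completion_time_measurable[of n "M n" "\<Omega> n" "X n"] elim
      by (simp add: T_def uniform_coupons_def)
  qed
  have rv: "eventually (\<lambda>n. prob_space (\<Omega> n) \<and> Y n \<in> borel_measurable (\<Omega> n)
      \<and> (\<forall>\<omega>\<in>space (\<Omega> n). 0 \<le> Y n \<omega>)) sequentially"
    using good meas by eventually_elim (auto simp: Y_def[abs_def])
  define G where "G n x = measure (\<Omega> n) {\<omega>\<in>space (\<Omega> n). x < Y n \<omega>}" for n x
  have tail_eq: "eventually (\<lambda>n. \<forall>x\<ge>0. G n x \<le> survival n (M n) (nat \<lfloor>x / rate n\<rfloor>)
      \<and> survival n (M n) (max (nat \<lfloor>x / rate n\<rfloor>) (M n)) \<le> G n x) sequentially"
    using good finite
  proof eventually_elim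
    case (elim n)
    have un: "uniform_coupons (\<Omega> n) n (X n)" using coupons elim by simp
    show ?case
    proof (intro allI impI)
      fix x :: real assume "x \<ge> 0"
      then have "G n x = measure (\<Omega> n) {\<omega>\<in>space (\<Omega> n). of_nat (nat \<lfloor>x / rate n\<rfloor>) < T n \<omega>}"
        unfolding G_def Y_def using elim un scaled_completion_time_tail[of n "M n" "\<Omega> n" "X n" "\<mu> n" x]
        by (simp add: T_def)
      then show "G n x \<le> survival n (M n) (nat \<lfloor>x / rate n\<rfloor>)
          \<and> survival n (M n) (max (nat \<lfloor>x / rate n\<rfloor>) (M n)) \<le> G n x"
        using completion_time_tail_bounds[of n "M n" "\<Omega> n" "X n"] elim un by (simp add: T_def)
    qed
  qed
  have tail: "(\<lambda>n. measure (\<Omega> n) {\<omega>\<in>space (\<Omega> n). x < Y n \<omega>}) \<longlonglongrightarrow> exp (- x)" if x: "x \<ge> 0" for x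
    unfolding G_def[symmetric]
  proof (rule tendsto_sandwich)
    have fl: "(\<lambda>n. rate n * real (nat \<lfloor>x / rate n\<rfloor>)) \<longlonglongrightarrow> x" by (rule rate_floor[OF x])
    \<comment> \<open>The lower bound on the tail sees only times from M on; since rate * M
      \<rightarrow> 0, this does not change the scaled time in the limit.\<close>
    have "(\<lambda>n. max (rate n * real (nat \<lfloor>x / rate n\<rfloor>)) (rate n * real (M n))) \<longlonglongrightarrow> max x 0"
      by (intro tendsto_max fl rate_M_0)
    moreover have "eventually (\<lambda>n. max (rate n * real (nat \<lfloor>x / rate n\<rfloor>)) (rate n * real (M n))
        = rate n * real (max (nat \<lfloor>x / rate n\<rfloor>) (M n))) sequentially"
      using eventually_full_prob_le by eventually_elim (simp add: max_mult_distrib_left of_nat_max)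
    ultimately have "(\<lambda>n. rate n * real (max (nat \<lfloor>x / rate n\<rfloor>) (M n))) \<longlonglongrightarrow> x"
      using x Lim_transform_eventually by fastforce
    then show "(\<lambda>n. survival n (M n) (max (nat \<lfloor>x / rate n\<rfloor>) (M n))) \<longlonglongrightarrow> exp (- x)"
      by (rule survival_tendsto)
    show "(\<lambda>n. survival n (M n) (nat \<lfloor>x / rate n\<rfloor>)) \<longlonglongrightarrow> exp (- x)"
      by (rule survival_tendsto[OF fl])
    show "eventually (\<lambda>n. G n x \<le> survival n (M n) (nat \<lfloor>x / rate n\<rfloor>)) sequentially"
      using tail_eq by eventually_elim (use x in blast)
    show "eventually (\<lambda>n. survival n (M n) (max (nat \<lfloor>x / rate n\<rfloor>) (M n)) \<le> G n x) sequentially"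
      using tail_eq by eventually_elim (use x in blast)
  qed
  have "eventually (\<lambda>n. rate n < 1) sequentially"
    using rate_0 by (rule order_tendstoD) simp
  then have dom: "eventually (\<lambda>n. \<forall>x\<ge>0. measure (\<Omega> n) {\<omega>\<in>space (\<Omega> n). x < Y n \<omega>}
      \<le> 2 * exp (1 / 2) * exp (- (x / 2))) sequentially"
    using tail_eq eventually_survival_le good
  proof eventually_elim
    case (elim n)
    show ?case
    proof (intro allI impI)
      fix x :: real assume x: "x \<ge> 0"
      let ?k = "nat \<lfloor>x / rate n\<rfloor>"
      \<comment> \<open>Rounding down costs one unit of time, hence \<open>rate n\<close> < 1 after
        scaling; this is the origin of exp (1 / 2).\<close>
      have "x / rate n - 1 \<le> real ?k" using x elim by (auto intro: less_imp_le)
      then have "rate n * (x / rate n - 1) \<le> rate n * real ?k" using elim by (intro mult_left_mono) auto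
      then have k: "x - 1 \<le> rate n * real ?k" using elim by (simp add: right_diff_distrib)
      have "G n x \<le> survival n (M n) ?k" using elim x by blast
      also have "\<dots> \<le> 2 * exp (- (rate n * real ?k / 2))" using elim by blast
      also have "\<dots> \<le> 2 * exp (1 / 2 - x / 2)" using k by simp
      also have "\<dots> = 2 * exp (1 / 2) * exp (- (x / 2))"
        unfolding mult.assoc exp_add[symmetric] by simp
      finally show "measure (\<Omega> n) {\<omega>\<in>space (\<Omega> n). x < Y n \<omega>} \<le> 2 * exp (1 / 2) * exp (- (x / 2))"
        by (simp add: G_def)
    qed
  qed
  have weak: "weak_conv_m (\<lambda>n. distr (\<Omega> n) borel (Y n)) (density lborel (exponential_density 1))"
    using rv tail by (rule exponential_weak_limit)
  have mom: "(\<lambda>n. \<integral>\<^sup>+\<omega>. ennreal (Y n \<omega> ^ Suc k) \<partial>\<Omega> n) \<longlonglongrightarrow> ennreal (fact (Suc k))" for k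
    using rv tail dom by (rule exponential_moment_limit)
  have moments: "(\<lambda>n. \<integral>\<^sup>+\<omega>. (ennreal (\<mu> n) * T n \<omega>) ^ r \<partial>\<Omega> n) \<longlonglongrightarrow> ennreal (fact r)" if "r \<ge> 1" for r
  proof -
    obtain k where r: "r = Suc k" using \<open>r \<ge> 1\<close> by (cases r) auto
    \<comment> \<open>T is infinite only on a null set, so its moments in the extended reals agree
      with those of Y.\<close>
    have "eventually (\<lambda>n. (\<integral>\<^sup>+\<omega>. ennreal (Y n \<omega> ^ Suc k) \<partial>\<Omega> n)
        = (\<integral>\<^sup>+\<omega>. (ennreal (\<mu> n) * T n \<omega>) ^ r \<partial>\<Omega> n)) sequentially"
      using good finite
    proof eventually_elim
      case (elim n)
      have "AE \<omega> in \<Omega> n. ennreal (Y n \<omega> ^ Suc k) = (ennreal (\<mu> n) * T n \<omega>) ^ r"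
        using elim(2)
      proof eventually_elim
        case (elim \<omega>)
        then have "T n \<omega> = ennreal (enn2real (T n \<omega>))" by simp
        then have "(ennreal (\<mu> n) * T n \<omega>) ^ r = (ennreal (\<mu> n) * ennreal (enn2real (T n \<omega>))) ^ r"
          by (simp only:)
        also have "\<dots> = ennreal (Y n \<omega> ^ Suc k)"
          using \<open>n \<ge> 1 \<and> n \<le> M n \<and> \<mu> n = rate n \<and> \<mu> n > 0\<close>
          by (simp add: Y_def r ennreal_power ennreal_mult[symmetric] del: power_Suc)
        finally show ?case ..
      qed
      then show ?case by (rule nn_integral_cong_AE)
    qed
    then show ?thesis using mom[of k] r Lim_transform_eventually by fastforce
  qed
  have integrals: "eventually (\<lambda>n. integrable (\<Omega> n) (\<lambda>\<omega>. Y n \<omega> ^ Suc k)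
      \<and> enn2real (\<integral>\<^sup>+\<omega>. ennreal (Y n \<omega> ^ Suc k) \<partial>\<Omega> n) = integral\<^sup>L (\<Omega> n) (\<lambda>\<omega>. Y n \<omega> ^ Suc k)) sequentially" for k
  proof -
    \<comment> \<open>Convergence to a finite limit forces the moments to be finite from some n on,
      which gives integrability.\<close>
    have "eventually (\<lambda>n. (\<integral>\<^sup>+\<omega>. ennreal (Y n \<omega> ^ Suc k) \<partial>\<Omega> n) < \<top>) sequentially"
      using mom[of k] by (rule order_tendstoD) simp
    then show ?thesis using rv
    proof eventually_elim
      case (elim n)
      then have [measurable]: "Y n \<in> borel_measurable (\<Omega> n)" by simp
      have nn: "AE \<omega> in \<Omega> n. 0 \<le> Y n \<omega> ^ Suc k" using elim by (intro AE_I2) simp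
      have "integrable (\<Omega> n) (\<lambda>\<omega>. Y n \<omega> ^ Suc k)"
        using nn elim by (intro integrableI_nonneg) auto
      moreover have "integral\<^sup>L (\<Omega> n) (\<lambda>\<omega>. Y n \<omega> ^ Suc k) = enn2real (\<integral>\<^sup>+\<omega>. ennreal (Y n \<omega> ^ Suc k) \<partial>\<Omega> n)"
        by (rule integral_eq_nn_integral[OF _ nn]) measurable
      ultimately show ?case by simp
    qed
  qed
  have real_mom: "(\<lambda>n. integral\<^sup>L (\<Omega> n) (\<lambda>\<omega>. Y n \<omega> ^ Suc k)) \<longlonglongrightarrow> fact (Suc k)" for k
  proof -
    have "(\<lambda>n. enn2real (\<integral>\<^sup>+\<omega>. ennreal (Y n \<omega> ^ Suc k) \<partial>\<Omega> n)) \<longlonglongrightarrow> fact (Suc k)"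
      by (rule tendsto_enn2real[OF mom]) simp
    moreover have "eventually (\<lambda>n. enn2real (\<integral>\<^sup>+\<omega>. ennreal (Y n \<omega> ^ Suc k) \<partial>\<Omega> n)
        = integral\<^sup>L (\<Omega> n) (\<lambda>\<omega>. Y n \<omega> ^ Suc k)) sequentially"
      using integrals[of k] by eventually_elim simp
    ultimately show ?thesis by (rule Lim_transform_eventually)
  qed
  have expect: "(\<lambda>n. prob_space.expectation (\<Omega> n) (\<lambda>\<omega>. enn2real (T n \<omega>))) \<sim>[sequentially] (\<lambda>n. 1 / \<mu> n)"
  proof (rule asymp_equivI')
    have "eventually (\<lambda>n. integral\<^sup>L (\<Omega> n) (\<lambda>\<omega>. Y n \<omega> ^ Suc 0)
        = prob_space.expectation (\<Omega> n) (\<lambda>\<omega>. enn2real (T n \<omega>)) / (1 / \<mu> n)) sequentially"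
      by (simp add: Y_def mult.commute)
    then show "(\<lambda>n. prob_space.expectation (\<Omega> n) (\<lambda>\<omega>. enn2real (T n \<omega>)) / (1 / \<mu> n)) \<longlonglongrightarrow> 1"
      using real_mom[of 0] Lim_transform_eventually by fastforce
  qed
  have var: "(\<lambda>n. prob_space.variance (\<Omega> n) (\<lambda>\<omega>. enn2real (T n \<omega>))) \<sim>[sequentially] (\<lambda>n. 1 / (\<mu> n)\<^sup>2)"
  proof (rule asymp_equivI')
    \<comment> \<open>The scaled variance tends to 2! - (1!)^2 = 1.\<close>
    have "(\<lambda>n. integral\<^sup>L (\<Omega> n) (\<lambda>\<omega>. Y n \<omega> ^ Suc 1) - (integral\<^sup>L (\<Omega> n) (\<lambda>\<omega>. Y n \<omega> ^ Suc 0))\<^sup>2)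
        \<longlonglongrightarrow> fact (Suc 1) - (fact (Suc 0))\<^sup>2"
      by (intro tendsto_intros real_mom)
    then have lim: "(\<lambda>n. integral\<^sup>L (\<Omega> n) (\<lambda>\<omega>. Y n \<omega> ^ Suc 1) - (integral\<^sup>L (\<Omega> n) (\<lambda>\<omega>. Y n \<omega> ^ Suc 0))\<^sup>2) \<longlonglongrightarrow> 1"
      by simp
    have "eventually (\<lambda>n. integral\<^sup>L (\<Omega> n) (\<lambda>\<omega>. Y n \<omega> ^ Suc 1) - (integral\<^sup>L (\<Omega> n) (\<lambda>\<omega>. Y n \<omega> ^ Suc 0))\<^sup>2
        = prob_space.variance (\<Omega> n) (\<lambda>\<omega>. enn2real (T n \<omega>)) / (1 / (\<mu> n)\<^sup>2)) sequentially"
      using good meas integrals[of 0] integrals[of 1]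
    proof eventually_elim
      case (elim n)
      interpret prob_space "\<Omega> n" using elim by simp
      let ?t = "\<lambda>\<omega>. enn2real (T n \<omega>)"
      have \<mu>: "\<mu> n \<noteq> 0" using elim by simp
      have i1: "integrable (\<Omega> n) ?t" using elim(3) \<mu> by (simp add: Y_def)
      have "integrable (\<Omega> n) (\<lambda>\<omega>. (\<mu> n)\<^sup>2 * (?t \<omega>)\<^sup>2)"
        using elim(4) by (simp add: Y_def power2_eq_square mult_ac)
      then have i2: "integrable (\<Omega> n) (\<lambda>\<omega>. (?t \<omega>)\<^sup>2)" using \<mu> by simp
      have "variance ?t / (1 / (\<mu> n)\<^sup>2) = (\<mu> n)\<^sup>2 * expectation (\<lambda>\<omega>. (?t \<omega>)\<^sup>2) - (\<mu> n * expectation ?t)\<^sup>2"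
        by (subst variance_eq[OF i1 i2]) (simp add: algebra_simps power_mult_distrib)
      also have "\<dots> = expectation (\<lambda>\<omega>. (\<mu> n)\<^sup>2 * (?t \<omega>)\<^sup>2) - (expectation (\<lambda>\<omega>. \<mu> n * ?t \<omega>))\<^sup>2"
        by simp
      finally show ?case by (simp add: Y_def power_mult_distrib flip: power2_eq_square)
    qed
    then show "(\<lambda>n. prob_space.variance (\<Omega> n) (\<lambda>\<omega>. enn2real (T n \<omega>)) / (1 / (\<mu> n)\<^sup>2)) \<longlonglongrightarrow> 1"
      by (rule Lim_transform_eventually[OF lim])
  qed
  show ?thesis
    using finite weak moments expect var unfolding Y_def[abs_def] by blast
qed

end
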